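(* Let $\mathcal G=(\mathcal V,\mathcal E,\omega)$ be a connected weighted hypergraph and let $\mathbf G$, $\mathbf A_\theta$, $\mathbf Q_\phi$, $R_\theta$, $\tau_\eta$, $\mathcal R_\eta$ be as defined in the context. For every initial condition $\mathbf X_0\in\mathcal X=\mathbb R^{n\times d}$, the Hypergraph Neural Reaction--Diffusion (HNRD) equation $$\frac{d\mathbf X(t)}{dt}=-\mathbf G^\top\mathbf A_\theta(\mathbf X(t))\,\mathbf G\,\mathbf X(t)+\mathcal R_\eta(\mathbf X(t)),\qquad \mathbf X(0)=\mathbf X_0,$$ admits a unique global classical solution $\mathbf X(\cdot\,;\mathbf X_0)\in C^1([0,\infty);\mathcal X)$. Consequently, the solution operator $\mathbf S_R(t)\mathbf X_0:=\mathbf X(t;\mathbf X_0)$, $t\ge0$, defines a global continuous semiflow $\{\mathbf S_R(t)\}_{t\ge0}$ on $\mathcal X$.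
   Context: Hypergraph. $\mathcal V$ is a finite set of $n\ge 2$ nodes, $\mathcal E$ a finite set of hyperedges, each $e\in\mathcal E$ being a subset of $\mathcal V$ with $|e|\ge 2$, and $\omega_e>0$ is the weight of $e$. The degree of $v$ is $d_v=\#\{e\in\mathcal E: v\in e\}$ (unweighted). The hypergraph is connected if any two nodes can be joined by a finite sequence of nodes in which consecutive nodes lie in a common hyperedge; then $d_v\ge 1$ for all $v$. The incidence set is $\mathcal I=\{(e,v): e\in\mathcal E, v\in e\}$ and $N=|\mathcal I|$. Phase space. $\mathcal X=\mathbb R^{n\times d}$ with Frobenius inner product $\langle\cdot,\cdot\rangle_F$ and norm $\|\cdot\|_F$; row $\mathbf X_v$ of $\mathbf X$ is the representation of node $v$. A continuous semiflow on $\mathcal X$ is a family of maps $\mathbf S(t):\mathcal X\to\mathcal X$, $t\ge0$, with $\mathbf S(0)=\mathbf I$, $\mathbf S(t+s)=\mathbf S(t)\circ\mathbf S(s)$ for $t,s\ge0$, and $(t,x)\mapsto\mathbf S(t)x$ continuous from $[0,\infty)\times\mathcal X$ to $\mathcal X$. Gradient matrix. $\mathbf G\in\mathbb R^{N\times n}$ is $\mathbf G=\mathbf\Omega_{\mathcal I}^{1/2}\mathbf P$, where $\mathbf\Omega_{\mathcal I}=\operatorname{diag}(\omega_e)_{(e,v)\in\mathcal I}$ and $(\mathbf P\mathbf f)(e,v)=\frac{\mathbf f(v)}{\sqrt{d_v}}-\frac1{|e|}\sum_{u\in e}\frac{\mathbf f(u)}{\sqrt{d_u}}$; it acts on $\mathbf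 X\in\mathcal X$ columnwise. Modulation. Fix parameters $\theta$ and $0<\varepsilon<1$. For $\mathbf X\in\mathcal X$ let $\mathbf X_e=\operatorname{Agg}(\{\mathbf X_u:u\in e\})\in\mathbb R^d$, with $\operatorname{Agg}$ a permutation-invariant, locally Lipschitz aggregator (such as mean or max pooling), and $r^\theta_{(e,v)}=\sigma(\operatorname{MLP}_\theta(\mathbf X_v\,\|\,\mathbf X_e))\in\mathbb R$, where $\|$ is concatenation, $\sigma$ is LeakyReLU and $\operatorname{MLP}_\theta:\mathbb R^{2d}\to\mathbb R$ is a (locally Lipschitz) multilayer perceptron. Set $$a_\theta(\mathbf X_v,\mathbf X_e)=(1-\varepsilon)\frac{\exp(r^\theta_{(e,v)})}{\sum_{e'\ni v}\exp(r^\theta_{(e',v)})}+\frac{\varepsilon}{d_v},\qquad \mathbf A_\theta(\mathbf X)=\operatorname{diag}(a_\theta(\mathbf X_v,\mathbf X_e))_{(e,v)\in\mathcal I}\in\mathbb R^{N\times N}.$$ Null mode. $\mathbf D_v=\operatorname{diag}(d_v)_{v\in\mathcal V}$, $\phi=\mathbf D_v^{1/2}\mathbf 1\in\mathbb R^n$, $\mathcal S_\phi=\{\phi c: c\in\mathbb R^{1\times d}\}\subset\mathcal X$, $\mathbf\Pi_\phi$ is the orthogonal projector of $\mathcal X$ onto $\mathcal S_\phi$, and $\mathbf Q_\phi=\mathbf I-\mathbf\Pi_\phi$. Reaction term. With $\mathbf Z=\mathbf Q_\phi\mathbf X$, $$R_\theta(\mathbf X)=\frac{\langle\mathbf G\mathbf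 Z,\mathbf A_\theta(\mathbf X)\mathbf G\mathbf Z\rangle_F}{\|\mathbf Z\|_F^2}\ \text{ if }\mathbf Z\ne0,\qquad R_\theta(\mathbf X)=0\ \text{ if }\mathbf Z=0,$$ $$\mathcal R_\eta(\mathbf X)=\bigl[R_\theta(\mathbf X)+\tanh(\tau_\eta-\|\mathbf Q_\phi\mathbf X\|_F^2)\bigr]\mathbf Q_\phi\mathbf X,\qquad \tau_\eta=\operatorname{softplus}(\eta)=\log(1+e^\eta)>0,\ \eta\in\mathbb R\text{ fixed}.$$ *)

theory Defs
  imports "HOL-Analysis.Analysis" "HOL-Library.Multiset"
begin

section \<open>Hypergraphs\<close>

text \<open>The node set is the finite type \<open>'n\<close>; hyperedges are subsets of it. A feature matrix in
  \<open>\<real>\<^sup>n\<^sup>\<times>\<^sup>d\<close> has type \<open>real^'d^'n\<close>, with \<open>X $ v\<close> the row of \<open>v\<close>; on this type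
  \<open>inner\<close> and \<open>norm\<close> are the Frobenius inner product and norm.\<close>

definition weighted_hypergraph :: "('n::finite) set set \<Rightarrow> ('n set \<Rightarrow> real) \<Rightarrow> bool" where
  "weighted_hypergraph E \<omega> \<longleftrightarrow>
     CARD('n) \<ge> 2 \<and> (\<forall>e\<in>E. card e \<ge> 2) \<and> (\<forall>e\<in>E. \<omega> e > 0)"

definition hg_connected :: "('n::finite) set set \<Rightarrow> bool" where
  "hg_connected E \<longleftrightarrow> (\<forall>u v. (u, v) \<in> {(x, y). \<exists>e\<in>E. x \<in> e \<and> y \<in> e}\<^sup>*)"

definition hg_degree :: "('n::finite) set set \<Rightarrow> 'n \<Rightarrow> nat" where
  "hg_degree E v = card {e \<in> E. v \<in> e}"

definition incidences :: "('n::finite) set set \<Rightarrow> ('n set \<times> 'n) set" where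
  "incidences E = {(e, v). e \<in> E \<and> v \<in> e}"

definition diag_matrix :: "('i::finite \<Rightarrow> real) \<Rightarrow> real^'i^'i" where
  "diag_matrix d = (\<chi> i j. if i = j then d i else 0)"

section \<open>Gradient matrix\<close>

text \<open>Matrices indexed by the incidence set are represented with index type \<open>'n set \<times> 'n\<close>, all
  entries involving a pair outside \<open>incidences E\<close> being zero. This zero padding does not affect
  products contracted over incidences or Frobenius inner products.\<close>

definition incidence_diff ::
  "('n::finite) set set \<Rightarrow> real^'n \<Rightarrow> real^('n set \<times> 'n)" where
  "incidence_diff E f = (\<chi> i. if i \<in> incidences E
     then f $ snd i / sqrt (real (hg_degree E (snd i)))
          - (\<Sum>u\<in>fst i. f $ u / sqrt (real (hg_degree E u))) / real (card (fst i))
     else 0)"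

definition sqrt_weight_matrix ::
  "('n::finite) set set \<Rightarrow> ('n set \<Rightarrow> real) \<Rightarrow> real^('n set \<times> 'n)^('n set \<times> 'n)" where
  "sqrt_weight_matrix E \<omega> =
     diag_matrix (\<lambda>i. if i \<in> incidences E then sqrt (\<omega> (fst i)) else 0)"

definition gradient_matrix ::
  "('n::finite) set set \<Rightarrow> ('n set \<Rightarrow> real) \<Rightarrow> real^'n^('n set \<times> 'n)" where
  "gradient_matrix E \<omega> = sqrt_weight_matrix E \<omega> ** matrix (incidence_diff E)"

section \<open>Modulation\<close>

definition locally_lipschitz :: "('a::metric_space \<Rightarrow> 'b::metric_space) \<Rightarrow> bool" where
  "locally_lipschitz f \<longleftrightarrow> (\<forall>x. \<exists>u>0. \<exists>L. L-lipschitz_on (cball x u) f)"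

text \<open>An aggregator maps finite multisets of row vectors to a row vector, so permutation invariance
  is part of its type.\<close>

definition edge_feature ::
  "((real^'d) multiset \<Rightarrow> real^'d) \<Rightarrow> real^'d^'n \<Rightarrow> ('n::finite) set \<Rightarrow> real^'d" where
  "edge_feature Agg X e = Agg (image_mset (\<lambda>u. X $ u) (mset_set e))"

text \<open>Local Lipschitz continuity of an aggregator is that of the maps
  \<open>(x\<^sub>1, \<dots>, x\<^sub>k) \<mapsto> Agg {#x\<^sub>1, \<dots>, x\<^sub>k#}\<close> for \<open>1 \<le> k \<le> n\<close>. The \<open>k\<close>-tuples are here the families
  \<open>(X\<^sub>u)\<^sub>u\<^sub>\<in>\<^sub>e\<close> for \<open>e\<close> a set of \<open>k\<close> nodes; the rows outside \<open>e\<close> play no role.\<close>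

definition locally_lipschitz_aggregator ::
  "'n::finite itself \<Rightarrow> ((real^'d) multiset \<Rightarrow> real^'d) \<Rightarrow> bool" where
  "locally_lipschitz_aggregator _ Agg \<longleftrightarrow>
     (\<forall>e::'n set. e \<noteq> {} \<longrightarrow> locally_lipschitz (\<lambda>X::real^'d^'n. edge_feature Agg X e))"

definition leaky_relu :: "real \<Rightarrow> real \<Rightarrow> real" where
  "leaky_relu \<alpha> x = (if x \<ge> 0 then x else \<alpha> * x)"

text \<open>A multilayer perceptron with inputs in \<open>real^'i\<close> and scalar output. A layer is a list of neurons,
  a neuron being a weight vector together with a bias; the width of a layer is the length of its
  list. A neuron fed by a layer of width \<open>m\<close> uses only the weights \<open>w 0, \<dots>, w (m - 1)\<close>. The
  parameters are the first hidden layer, the list of further hidden layers, and the output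
  neuron; \<open>\<rho>\<close> is the activation of the hidden layers.\<close>

type_synonym neuron = "(nat \<Rightarrow> real) \<times> real"

type_synonym 'i mlp_params = "((real^'i) \<times> real) list \<times> neuron list list \<times> neuron"

definition neuron_affine :: "neuron \<Rightarrow> real list \<Rightarrow> real" where
  "neuron_affine N y = (\<Sum>i<length y. fst N i * y ! i) + snd N"

definition mlp :: "(real \<Rightarrow> real) \<Rightarrow> ('i::finite) mlp_params \<Rightarrow> real^'i \<Rightarrow> real" where
  "mlp \<rho> \<theta> x = (case \<theta> of (first_layer, further_layers, out_neuron) \<Rightarrow>
     neuron_affine out_neuron
       (fold (\<lambda>layer y. map (\<lambda>N. \<rho> (neuron_affine N y)) layer) further_layers
         (map (\<lambda>(w, b). \<rho> (w \<bullet> x + b)) first_layer)))"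

definition vec_concat :: "real^'d \<Rightarrow> real^'d \<Rightarrow> real^('d + 'd)" where
  "vec_concat x y = (\<chi> i. case i of Inl j \<Rightarrow> x $ j | Inr j \<Rightarrow> y $ j)"

definition attention_score ::
  "real \<Rightarrow> (real \<Rightarrow> real) \<Rightarrow> ('d + 'd) mlp_params \<Rightarrow> ((real^'d) multiset \<Rightarrow> real^'d)
   \<Rightarrow> real^'d^'n \<Rightarrow> ('n::finite) set \<Rightarrow> 'n \<Rightarrow> real" where
  "attention_score \<alpha> \<rho> \<theta> Agg X e v =
     leaky_relu \<alpha> (mlp \<rho> \<theta> (vec_concat (X $ v) (edge_feature Agg X e)))"

definition attention_weight ::
  "('n::finite) set set \<Rightarrow> real \<Rightarrow> real \<Rightarrow> (real \<Rightarrow> real) \<Rightarrow> ('d + 'd) mlp_params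
   \<Rightarrow> ((real^'d) multiset \<Rightarrow> real^'d) \<Rightarrow> real^'d^'n \<Rightarrow> 'n set \<Rightarrow> 'n \<Rightarrow> real" where
  "attention_weight E \<epsilon> \<alpha> \<rho> \<theta> Agg X e v =
     (1 - \<epsilon>) * (exp (attention_score \<alpha> \<rho> \<theta> Agg X e v)
                / (\<Sum>e' | e' \<in> E \<and> v \<in> e'. exp (attention_score \<alpha> \<rho> \<theta> Agg X e' v)))
     + \<epsilon> / real (hg_degree E v)"

definition attention_matrix ::
  "('n::finite) set set \<Rightarrow> real \<Rightarrow> real \<Rightarrow> (real \<Rightarrow> real) \<Rightarrow> ('d + 'd) mlp_params
   \<Rightarrow> ((real^'d) multiset \<Rightarrow> real^'d) \<Rightarrow> real^'d^'n \<Rightarrow> real^('n set \<times> 'n)^('n set \<times> 'n)" where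
  "attention_matrix E \<epsilon> \<alpha> \<rho> \<theta> Agg X =
     diag_matrix (\<lambda>i. if i \<in> incidences E
       then attention_weight E \<epsilon> \<alpha> \<rho> \<theta> Agg X (fst i) (snd i) else 0)"

section \<open>Null mode\<close>

definition null_vector :: "('n::finite) set set \<Rightarrow> real^'n" where
  "null_vector E = diag_matrix (\<lambda>v. sqrt (real (hg_degree E v))) *v 1"

definition null_space :: "('n::finite) set set \<Rightarrow> (real^'d^'n) set" where
  "null_space E = {(\<chi> v. null_vector E $ v *\<^sub>R c) | c. True}"

definition orth_projector :: "('a::euclidean_space) set \<Rightarrow> 'a \<Rightarrow> 'a" where
  "orth_projector S x = (THE y. y \<in> S \<and> (\<forall>z\<in>S. orthogonal (x - y) z))"

definition Q_proj :: "('n::finite) set set \<Rightarrow> real^'d^'n \<Rightarrow> real^'d^'n" where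
  "Q_proj E X = X - orth_projector (null_space E) X"

section \<open>Reaction term and the vector field\<close>

definition reaction_quotient ::
  "('n::finite) set set \<Rightarrow> ('n set \<Rightarrow> real) \<Rightarrow> real \<Rightarrow> real \<Rightarrow> (real \<Rightarrow> real)
   \<Rightarrow> ('d + 'd) mlp_params \<Rightarrow> ((real^'d) multiset \<Rightarrow> real^'d) \<Rightarrow> real^'d^'n \<Rightarrow> real" where
  "reaction_quotient E \<omega> \<epsilon> \<alpha> \<rho> \<theta> Agg X =
     (let Z = Q_proj E X; GZ = gradient_matrix E \<omega> ** Z in
      if Z \<noteq> 0 then (GZ \<bullet> (attention_matrix E \<epsilon> \<alpha> \<rho> \<theta> Agg X ** GZ)) / (norm Z)\<^sup>2 else 0)"

definition softplus :: "real \<Rightarrow> real" where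
  "softplus \<eta> = ln (1 + exp \<eta>)"

definition reaction_term ::
  "('n::finite) set set \<Rightarrow> ('n set \<Rightarrow> real) \<Rightarrow> real \<Rightarrow> real \<Rightarrow> (real \<Rightarrow> real)
   \<Rightarrow> ('d + 'd) mlp_params \<Rightarrow> ((real^'d) multiset \<Rightarrow> real^'d) \<Rightarrow> real
   \<Rightarrow> real^'d^'n \<Rightarrow> real^'d^'n" where
  "reaction_term E \<omega> \<epsilon> \<alpha> \<rho> \<theta> Agg \<eta> X =
     (reaction_quotient E \<omega> \<epsilon> \<alpha> \<rho> \<theta> Agg X + tanh (softplus \<eta> - (norm (Q_proj E X))\<^sup>2))
       *\<^sub>R Q_proj E X"

definition hnrd_field ::
  "('n::finite) set set \<Rightarrow> ('n set \<Rightarrow> real) \<Rightarrow> real \<Rightarrow> real \<Rightarrow> (real \<Rightarrow> real)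
   \<Rightarrow> ('d + 'd) mlp_params \<Rightarrow> ((real^'d) multiset \<Rightarrow> real^'d) \<Rightarrow> real
   \<Rightarrow> real^'d^'n \<Rightarrow> real^'d^'n" where
  "hnrd_field E \<omega> \<epsilon> \<alpha> \<rho> \<theta> Agg \<eta> X =
     - (transpose (gradient_matrix E \<omega>) **
          (attention_matrix E \<epsilon> \<alpha> \<rho> \<theta> Agg X ** (gradient_matrix E \<omega> ** X)))
     + reaction_term E \<omega> \<epsilon> \<alpha> \<rho> \<theta> Agg \<eta> X"

section \<open>Global classical solutions and semiflows\<close>

text \<open>A global solution lives on \<open>[0,\<infty>)\<close>: values of \<open>X\<close> at negative times are irrelevant, and the
  derivative at \<open>0\<close> is one-sided.\<close>

definition global_classical_solution ::
  "('a::real_normed_vector \<Rightarrow> 'a) \<Rightarrow> 'a \<Rightarrow> (real \<Rightarrow> 'a) \<Rightarrow> bool" where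
  "global_classical_solution F x0 X \<longleftrightarrow>
     X 0 = x0 \<and>
     (\<exists>X'. continuous_on {0..} X' \<and>
        (\<forall>t\<ge>0. (X has_vector_derivative X' t) (at t within {0..}) \<and> X' t = F (X t)))"

text \<open>Meaningful at \<open>t \<ge> 0\<close> whenever global classical solutions exist and are unique.\<close>

definition solution_operator ::
  "('a::real_normed_vector \<Rightarrow> 'a) \<Rightarrow> real \<Rightarrow> 'a \<Rightarrow> 'a" where
  "solution_operator F t x0 = (THE x. \<exists>X. global_classical_solution F x0 X \<and> x = X t)"

definition continuous_semiflow ::
  "(real \<Rightarrow> 'a::topological_space \<Rightarrow> 'a) \<Rightarrow> bool" where
  "continuous_semiflow S \<longleftrightarrow>
     S 0 = id \<and>
     (\<forall>t\<ge>0. \<forall>s\<ge>0. S (t + s) = S t \<circ> S s) \<and>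
     continuous_on ({0..} \<times> UNIV) (\<lambda>(t, x). S t x)"

end

theory Submission
  imports Defs
begin

text \<open>The attention weights lie in \<open>[0,1]\<close> and the reaction quotient is a Rayleigh quotient, so the
  vector field \<open>F\<close> satisfies \<open>\<parallel>F X\<parallel> \<le> C \<parallel>X\<parallel>\<close>; it is also Lipschitz on every ball. By the growth bound
  all Picard iterates from \<open>x\<close> satisfy \<open>\<parallel>X\<^sub>k t\<parallel> \<le> \<parallel>x\<parallel> e\<^bsup>C t\<^esup>\<close>. On \<open>[0,T]\<close> they therefore stay in a ball
  on which \<open>F\<close> has a single Lipschitz constant, and they converge uniformly there: this gives global
  solutions without continuation or blow-up arguments. Gronwall estimates give uniqueness
  and continuous dependence, hence the semiflow.\<close>

section \<open>Functions that are Lipschitz on balls\<close>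

text \<open>Two obstacles shape the argument. The value of \<open>reaction_quotient\<close> depends
  on the direction of \<open>Q_proj E X\<close>, so it need not have a limit where this projection
  vanishes. The product with \<open>Q_proj E X\<close> is therefore rewritten with a polynomial form
  evaluated at the bounded vector \<open>sgn (Q_proj E X)\<close>; the same rewriting yields both
  the Lipschitz property and the linear growth. The other ingredients are only locally Lipschitz and
  get multiplied and composed. Being Lipschitz on every ball around 0 is stable under these
  operations, and it supplies the single constant that Picard iteration and the Gronwall estimate
  need on a bounded set. In finite dimension it follows from local Lipschitz continuity, because
  closed balls are compact.\<close>

definition lipschitz_on_balls :: "('a::real_normed_vector \<Rightarrow> 'b::metric_space) \<Rightarrow> bool" where
  "lipschitz_on_balls f \<longleftrightarrow> (\<forall>r. \<exists>L. L-lipschitz_on (cball 0 r) f)"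

lemma lipschitz_on_ballsI:
  fixes f :: "'a::real_normed_vector \<Rightarrow> 'b::real_normed_vector"
  assumes "\<And>r. \<exists>L. \<forall>x y. norm x \<le> r \<longrightarrow> norm y \<le> r \<longrightarrow> norm (f x - f y) \<le> L * norm (x - y)"
  shows "lipschitz_on_balls f"
  unfolding lipschitz_on_balls_def
proof
  fix r
  obtain L where L: "\<And>x y. norm x \<le> r \<Longrightarrow> norm y \<le> r \<Longrightarrow> norm (f x - f y) \<le> L * norm (x - y)"
    using assms[of r] by blast
  \<comment> \<open>\<open>lipschitz_on\<close> demands a nonnegative constant; the hypothesis
    admits a negative \<open>L\<close> when the ball has no two distinct points.\<close>
  have "\<bar>L\<bar>-lipschitz_on (cball 0 r) f"
  proof (rule lipschitz_onI)
    fix x y :: 'a assume "x \<in> cball 0 r" "y \<in> cball 0 r"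
    then have "norm (f x - f y) \<le> L * norm (x - y)" using L by simp
    also have "\<dots> \<le> \<bar>L\<bar> * norm (x - y)" by (intro mult_right_mono) auto
    finally show "dist (f x) (f y) \<le> \<bar>L\<bar> * dist x y" by (simp add: dist_norm)
  qed simp
  then show "\<exists>L. L-lipschitz_on (cball 0 r) f" by blast
qed

lemma lipschitz_on_ballsE:
  fixes f :: "'a::real_normed_vector \<Rightarrow> 'b::real_normed_vector"
  assumes "lipschitz_on_balls f"
  obtains L where "L \<ge> 0"
    and "\<And>x y. norm x \<le> r \<Longrightarrow> norm y \<le> r \<Longrightarrow> norm (f x - f y) \<le> L * norm (x - y)"
proof -
  obtain L where L: "L-lipschitz_on (cball 0 r) f"
    using assms unfolding lipschitz_on_balls_def by blast
  show thesis
    using lipschitz_on_nonneg[OF L] lipschitz_on_normD[OF L] by (intro that[of L]) auto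
qed

lemma lipschitz_on_balls_bound:
  fixes f :: "'a::real_normed_vector \<Rightarrow> 'b::real_normed_vector"
  assumes "lipschitz_on_balls f"
  obtains B where "B \<ge> 0" and "\<And>x. norm x \<le> r \<Longrightarrow> norm (f x) \<le> B"
proof -
  \<comment> \<open>The radius \<open>\<bar>r\<bar>\<close> keeps the comparison point 0 inside the
    ball even for negative \<open>r\<close>.\<close>
  obtain L where L: "L \<ge> 0" "\<And>x y. norm x \<le> \<bar>r\<bar> \<Longrightarrow> norm y \<le> \<bar>r\<bar> \<Longrightarrow> norm (f x - f y) \<le> L * norm (x - y)"
    by (rule lipschitz_on_ballsE[OF assms, of "\<bar>r\<bar>"]) blast
  have "norm (f x) \<le> L * \<bar>r\<bar> + norm (f 0)" if "norm x \<le> r" for x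
  proof -
    have "norm (f x) \<le> norm (f x - f 0) + norm (f 0)" using norm_triangle_ineq[of "f x - f 0" "f 0"] by simp
    also have "norm (f x - f 0) \<le> L * norm (x - 0)" using that by (intro L(2)) auto
    also have "L * norm (x - 0) \<le> L * \<bar>r\<bar>" using that L(1) by (intro mult_left_mono) auto
    finally show ?thesis by simp
  qed
  with L(1) show thesis by (intro that[of "L * \<bar>r\<bar> + norm (f 0)"]) auto
qed

lemma lipschitz_on_balls_continuous:
  fixes f :: "'a::real_normed_vector \<Rightarrow> 'b::metric_space"
  assumes "lipschitz_on_balls f"
  shows "continuous_on UNIV f"
proof -
  have "isCont f x" for x
  proof -
    obtain L where "L-lipschitz_on (cball 0 (norm x + 1)) f"
      using assms unfolding lipschitz_on_balls_def by blast
    then have "L-lipschitz_on (ball 0 (norm x + 1)) f"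
      by (rule lipschitz_on_subset) auto
    then have "continuous_on (ball 0 (norm x + 1)) f" by (rule lipschitz_on_continuous_on)
    then show ?thesis by (rule continuous_on_interior) (simp add: interior_open)
  qed
  then show ?thesis by (simp add: continuous_at_imp_continuous_on)
qed

lemma locally_lipschitz_imp_lipschitz_on_balls:
  fixes f :: "'a::euclidean_space \<Rightarrow> 'b::metric_space"
  assumes "locally_lipschitz f"
  shows "lipschitz_on_balls f"
  unfolding lipschitz_on_balls_def
proof
  fix r
  \<comment> \<open>The compactness theorem concerns time-dependent maps; the time set is a single
    dummy instant.\<close>
  have "local_lipschitz {0::real} (cball 0 r) (\<lambda>_. f)"
    unfolding local_lipschitz_def
  proof clarify
    fix x :: 'a
    obtain u L where "u > 0" "L-lipschitz_on (cball x u) f"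
      using assms unfolding locally_lipschitz_def by blast
    then show "\<exists>u>0. \<exists>L. \<forall>t\<in>cball 0 u \<inter> {0::real}. L-lipschitz_on (cball x u \<inter> cball 0 r) f"
      by (meson lipschitz_on_subset inf_le1)
  qed
  then obtain L where "\<And>t. t \<in> {0::real} \<Longrightarrow> L-lipschitz_on (cball 0 r) f"
    by (rule local_lipschitz_compact_implies_lipschitz) auto
  then show "\<exists>L. L-lipschitz_on (cball 0 r) f" by blast
qed

section \<open>Closure under composition, sums, products and components\<close>

lemma lipschitz_on_balls_compose:
  fixes f :: "'a::real_normed_vector \<Rightarrow> 'b::real_normed_vector"
    and g :: "'b \<Rightarrow> 'c::real_normed_vector"
  assumes "lipschitz_on_balls g" and "lipschitz_on_balls f"
  shows "lipschitz_on_balls (\<lambda>x. g (f x))"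
proof (rule lipschitz_on_ballsI)
  fix r
  obtain B where B: "\<And>x. norm x \<le> r \<Longrightarrow> norm (f x) \<le> B"
    using lipschitz_on_balls_bound[OF assms(2)] by metis
  obtain L where L: "L \<ge> 0" "\<And>x y. norm x \<le> r \<Longrightarrow> norm y \<le> r \<Longrightarrow> norm (f x - f y) \<le> L * norm (x - y)"
    by (rule lipschitz_on_ballsE[OF assms(2), of r]) blast
  \<comment> \<open>The image of the ball under \<open>f\<close> lies in the ball of radius
    \<open>B\<close>, so the constant of \<open>g\<close> is taken there.\<close>
  obtain M where M: "M \<ge> 0" "\<And>x y. norm x \<le> B \<Longrightarrow> norm y \<le> B \<Longrightarrow> norm (g x - g y) \<le> M * norm (x - y)"
    by (rule lipschitz_on_ballsE[OF assms(1), of B]) blast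
  have "norm (g (f x) - g (f y)) \<le> M * L * norm (x - y)" if "norm x \<le> r" "norm y \<le> r" for x y
    using order_trans[OF M(2)[OF B[OF that(1)] B[OF that(2)]] mult_left_mono[OF L(2)[OF that] M(1)]]
    by (simp add: mult.assoc)
  then show "\<exists>L. \<forall>x y. norm x \<le> r \<longrightarrow> norm y \<le> r \<longrightarrow> norm (g (f x) - g (f y)) \<le> L * norm (x - y)"
    by blast
qed

lemma lipschitz_on_balls_const: "lipschitz_on_balls (\<lambda>x. c)"
  unfolding lipschitz_on_balls_def using lipschitz_on_constant by blast

lemma lipschitz_on_balls_add:
  fixes f g :: "'a::real_normed_vector \<Rightarrow> 'b::real_normed_vector"
  assumes "lipschitz_on_balls f" and "lipschitz_on_balls g"
  shows "lipschitz_on_balls (\<lambda>x. f x + g x)"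
  using assms unfolding lipschitz_on_balls_def by (blast intro: lipschitz_on_add)

lemma lipschitz_on_balls_minus:
  fixes f :: "'a::real_normed_vector \<Rightarrow> 'b::real_normed_vector"
  assumes "lipschitz_on_balls f"
  shows "lipschitz_on_balls (\<lambda>x. - f x)"
  using assms unfolding lipschitz_on_balls_def by simp

lemma lipschitz_on_balls_diff:
  fixes f g :: "'a::real_normed_vector \<Rightarrow> 'b::real_normed_vector"
  assumes "lipschitz_on_balls f" and "lipschitz_on_balls g"
  shows "lipschitz_on_balls (\<lambda>x. f x - g x)"
  using lipschitz_on_balls_add[OF assms(1) lipschitz_on_balls_minus[OF assms(2)]] by simp

lemma lipschitz_on_balls_sum:
  fixes f :: "'i \<Rightarrow> 'a::real_normed_vector \<Rightarrow> 'b::real_normed_vector"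
  assumes "\<And>i. i \<in> I \<Longrightarrow> lipschitz_on_balls (f i)"
  shows "lipschitz_on_balls (\<lambda>x. \<Sum>i\<in>I. f i x)"
  using assms
  by (induction I rule: infinite_finite_induct)
     (auto intro: lipschitz_on_balls_const lipschitz_on_balls_add)

lemma lipschitz_on_balls_linear:
  assumes "bounded_linear f"
  shows "lipschitz_on_balls f"
proof -
  interpret bounded_linear f by fact
  obtain K where "\<And>x. norm (f x) \<le> norm x * K" using bounded by blast
  then have "norm (f x - f y) \<le> K * norm (x - y)" for x y
    by (simp flip: diff add: mult.commute)
  then show ?thesis by (intro lipschitz_on_ballsI) blast
qed

text \<open>Products are why balls are used: globally Lipschitz functions are not closed under them,
  but on a ball both factors are bounded. Matrix, scalar and inner products are all
  instances.\<close>

lemma lipschitz_on_balls_bilinear: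
  assumes "bounded_bilinear h" and "lipschitz_on_balls f" and "lipschitz_on_balls g"
  shows "lipschitz_on_balls (\<lambda>x. h (f x) (g x))"
proof (rule lipschitz_on_ballsI)
  fix r
  interpret bounded_bilinear h by fact
  obtain K where K: "K > 0" "\<And>a b. norm (h a b) \<le> norm a * norm b * K" using pos_bounded by blast
  obtain A where A: "A \<ge> 0" "\<And>x. norm x \<le> r \<Longrightarrow> norm (f x) \<le> A"
    using lipschitz_on_balls_bound[OF assms(2)] by metis
  obtain B where B: "B \<ge> 0" "\<And>x. norm x \<le> r \<Longrightarrow> norm (g x) \<le> B"
    using lipschitz_on_balls_bound[OF assms(3)] by metis
  obtain L where L: "L \<ge> 0" "\<And>x y. norm x \<le> r \<Longrightarrow> norm y \<le> r \<Longrightarrow> norm (f x - f y) \<le> L * norm (x - y)"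
    by (rule lipschitz_on_ballsE[OF assms(2), of r]) blast
  obtain M where M: "M \<ge> 0" "\<And>x y. norm x \<le> r \<Longrightarrow> norm y \<le> r \<Longrightarrow> norm (g x - g y) \<le> M * norm (x - y)"
    by (rule lipschitz_on_ballsE[OF assms(3), of r]) blast
  have "norm (h (f x) (g x) - h (f y) (g y)) \<le> (L * B * K + A * M * K) * norm (x - y)"
    if "norm x \<le> r" "norm y \<le> r" for x y
  proof -
    have "h (f x) (g x) - h (f y) (g y) = h (f x - f y) (g x) + h (f y) (g x - g y)"
      by (simp add: diff_left diff_right)
    then have "norm (h (f x) (g x) - h (f y) (g y)) \<le> norm (h (f x - f y) (g x)) + norm (h (f y) (g x - g y))"
      by (simp add: norm_triangle_ineq)
    also have "\<dots> \<le> norm (f x - f y) * norm (g x) * K + norm (f y) * norm (g x - g y) * K"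
      by (intro add_mono K)
    also have "\<dots> \<le> (L * norm (x - y)) * B * K + A * (M * norm (x - y)) * K"
      using that K(1) A B L M
      by (intro add_mono mult_mono mult_nonneg_nonneg) auto
    finally show ?thesis by (simp add: algebra_simps)
  qed
  then show "\<exists>L. \<forall>x y. norm x \<le> r \<longrightarrow> norm y \<le> r \<longrightarrow>
      norm (h (f x) (g x) - h (f y) (g y)) \<le> L * norm (x - y)" by blast
qed

lemma lipschitz_on_balls_C1:
  fixes f :: "real \<Rightarrow> real"
  assumes "\<And>x. (f has_real_derivative f' x) (at x)" and "continuous_on UNIV f'"
  shows "lipschitz_on_balls f"
proof (rule lipschitz_on_ballsI)
  fix r :: real
  have "bounded (f' ` cball 0 r)"
    using assms(2) by (intro compact_imp_bounded compact_continuous_image)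
      (auto intro: continuous_on_subset)
  then obtain B where B: "\<And>x. norm x \<le> r \<Longrightarrow> norm (f' x) \<le> B"
    unfolding bounded_iff by fastforce
  have "norm (f x - f y) \<le> B * norm (x - y)" if "norm x \<le> r" "norm y \<le> r" for x y
  proof (rule field_differentiable_bound)
    show "convex (cball (0::real) r)" by simp
    show "\<And>z. z \<in> cball 0 r \<Longrightarrow> (f has_field_derivative f' z) (at z within cball 0 r)"
      using assms(1) has_field_derivative_at_within by blast
  qed (use that B in auto)
  then show "\<exists>L. \<forall>x y. norm x \<le> r \<longrightarrow> norm y \<le> r \<longrightarrow> norm (f x - f y) \<le> L * norm (x - y)" by blast
qed

lemma norm_le_sum_norm_nth:
  fixes x :: "('a::real_normed_vector)^'n"
  shows "norm x \<le> (\<Sum>i\<in>UNIV. norm (x $ i))"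
  unfolding norm_vec_def by (rule L2_set_le_sum) simp

lemma lipschitz_on_balls_vec:
  fixes f :: "'a::real_normed_vector \<Rightarrow> ('b::real_normed_vector)^'n"
  assumes "\<And>i. lipschitz_on_balls (\<lambda>x. f x $ i)"
  shows "lipschitz_on_balls f"
proof (rule lipschitz_on_ballsI)
  fix r
  have "\<exists>L. \<forall>x y. norm x \<le> r \<longrightarrow> norm y \<le> r \<longrightarrow> norm (f x $ i - f y $ i) \<le> L * norm (x - y)" for i
    using lipschitz_on_ballsE[OF assms[of i], of r] by metis
  then obtain L where L: "\<And>i x y. norm x \<le> r \<Longrightarrow> norm y \<le> r \<Longrightarrow> norm (f x $ i - f y $ i) \<le> L i * norm (x - y)"
    by metis
  have "norm (f x - f y) \<le> (\<Sum>i\<in>UNIV. L i) * norm (x - y)" if "norm x \<le> r" "norm y \<le> r" for x y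
  proof -
    have "norm (f x - f y) \<le> (\<Sum>i\<in>UNIV. norm ((f x - f y) $ i))" by (rule norm_le_sum_norm_nth)
    also have "\<dots> \<le> (\<Sum>i\<in>UNIV. L i * norm (x - y))" using L[OF that] by (intro sum_mono) simp
    finally show ?thesis by (simp add: sum_distrib_right)
  qed
  then show "\<exists>L. \<forall>x y. norm x \<le> r \<longrightarrow> norm y \<le> r \<longrightarrow> norm (f x - f y) \<le> L * norm (x - y)" by blast
qed

section \<open>Autonomous equations with linear growth\<close>

text \<open>Gronwall in differential form. The squared norm is used because it is differentiable
  even where \<open>D\<close> vanishes; the integrating factor \<open>exp (- 2 * L * t)\<close>
  makes it nonincreasing. It is applied to one solution with the growth constant and to a difference
  of solutions with a Lipschitz constant.\<close>

lemma norm_le_exp_of_inner_le: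
  fixes D :: "real \<Rightarrow> 'a::real_inner"
  assumes der: "\<And>t. 0 \<le> t \<Longrightarrow> (D has_vector_derivative D' t) (at t within {0..})"
    and le: "\<And>t. 0 < t \<Longrightarrow> t < T \<Longrightarrow> D t \<bullet> D' t \<le> L * (norm (D t))\<^sup>2"
    and "0 \<le> T"
  shows "norm (D T) \<le> norm (D 0) * exp (L * T)"
proof -
  define u where "u t = (D t \<bullet> D t) * exp (- 2 * L * t)" for t
  have "u T \<le> u 0"
  proof (rule DERIV_nonpos_imp_decreasing_open[OF \<open>0 \<le> T\<close>])
    fix t :: real assume t: "0 < t" "t < T"
    \<comment> \<open>At interior times the one-sided derivative is two-sided; at the endpoints
      continuity suffices.\<close>
    have "at t within {0..} = at t" using t by (intro at_within_interior) (simp add: interior_real_atLeast)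
    then have D: "(D has_derivative (\<lambda>h. h *\<^sub>R D' t)) (at t)"
      using der[of t] t by (simp add: has_vector_derivative_def)
    have "((\<lambda>t. D t \<bullet> D t) has_derivative (\<lambda>h. h * (2 * (D t \<bullet> D' t)))) (at t)"
      by (rule derivative_eq_intros D refl)+ (auto simp: inner_commute algebra_simps)
    then have D2: "((\<lambda>t. D t \<bullet> D t) has_real_derivative 2 * (D t \<bullet> D' t)) (at t)"
      by (rule has_derivative_imp_has_field_derivative) simp
    have "(u has_real_derivative 2 * (D t \<bullet> D' t - L * (norm (D t))\<^sup>2) * exp (- 2 * L * t)) (at t)"
      unfolding u_def by (rule derivative_eq_intros D2 refl)+ (simp add: algebra_simps dot_square_norm)
    moreover have "2 * (D t \<bullet> D' t - L * (norm (D t))\<^sup>2) * exp (- 2 * L * t) \<le> 0"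
      using le[OF t] by (intro mult_nonpos_nonneg mult_nonneg_nonpos) auto
    ultimately show "\<exists>y. DERIV u t :> y \<and> y \<le> 0" by blast
  next
    have "continuous_on {0..T} D"
      unfolding continuous_on_eq_continuous_within
      using der has_vector_derivative_continuous has_vector_derivative_within_subset
      by (metis atLeastAtMost_iff atLeast_iff subsetI)
    then show "continuous_on {0..T} u" unfolding u_def by (intro continuous_intros)
  qed
  then have "(norm (D T))\<^sup>2 * exp (- 2 * L * T) \<le> (norm (D 0))\<^sup>2" by (simp add: u_def dot_square_norm)
  then have "(norm (D T))\<^sup>2 \<le> (norm (D 0))\<^sup>2 * exp (2 * L * T)" by (simp add: exp_minus field_simps)
  also have "\<dots> = (norm (D 0) * exp (L * T))\<^sup>2"
    by (simp add: power_mult_distrib mult.assoc flip: exp_double)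
  finally show ?thesis by (rule power2_le_imp_le) simp
qed

text \<open>The growth constant is global while Lipschitz constants may depend on the radius.
  Without an additive term in the bound, \<open>F\<close> vanishes at 0 and all norm estimates scale
  with the initial value.\<close>

locale linear_growth_field =
  fixes F :: "'a::euclidean_space \<Rightarrow> 'a" and C :: real
  assumes lipschitz: "lipschitz_on_balls F"
    and growth: "norm (F x) \<le> C * norm x"
    and C_nonneg: "0 \<le> C"
begin

section \<open>A priori bound, dependence on initial data and uniqueness\<close>

lemma solution_derivative:
  assumes "global_classical_solution F x X" and "0 \<le> t"
  shows "(X has_vector_derivative F (X t)) (at t within {0..})"
  using assms unfolding global_classical_solution_def by metis

lemma solution_initial: "global_classical_solution F x X \<Longrightarrow> X 0 = x"
  unfolding global_classical_solution_def by simp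

lemma solution_continuous:
  assumes "global_classical_solution F x X"
  shows "continuous_on {0..} X"
  unfolding continuous_on_eq_continuous_within
  using solution_derivative[OF assms] has_vector_derivative_continuous by fastforce

text \<open>Continuity of the derivative is automatic: a differentiable \<open>X\<close> is
  continuous, hence so is \<open>F\<close> along it.\<close>

lemma solutionI:
  assumes "X 0 = x" and "\<And>t. 0 \<le> t \<Longrightarrow> (X has_vector_derivative F (X t)) (at t within {0..})"
  shows "global_classical_solution F x X"
proof -
  have "continuous_on {0..} X"
    unfolding continuous_on_eq_continuous_within
    using assms(2) has_vector_derivative_continuous by fastforce
  then have "continuous_on {0..} (\<lambda>t. F (X t))"
    by (rule continuous_on_compose2[OF lipschitz_on_balls_continuous[OF lipschitz]]) auto
  then show ?thesis
    using assms unfolding global_classical_solution_def by blast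
qed

lemma solution_norm_le:
  assumes "global_classical_solution F x X" and "0 \<le> t"
  shows "norm (X t) \<le> norm x * exp (C * t)"
proof -
  have "X s \<bullet> F (X s) \<le> C * (norm (X s))\<^sup>2" for s
  proof -
    have "X s \<bullet> F (X s) \<le> norm (X s) * norm (F (X s))" by (rule norm_cauchy_schwarz)
    also have "\<dots> \<le> norm (X s) * (C * norm (X s))" by (intro mult_left_mono growth) simp
    finally show ?thesis by (simp add: power2_eq_square mult_ac)
  qed
  then show ?thesis
    using norm_le_exp_of_inner_le[of X "\<lambda>s. F (X s)" t C] solution_derivative[OF assms(1)]
      solution_initial[OF assms(1)] assms(2) by simp
qed

text \<open>Up to time \<open>T\<close> every solution starting in the ball of radius
  \<open>r\<close> stays in the ball of radius \<open>r * exp (C * T)\<close>. Hence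
  \<open>L\<close> can be fixed before the solutions are chosen; joint continuity of the semiflow
  relies on this uniformity.\<close>

lemma solutions_dist_le:
  obtains L where "\<And>x y X Y t. global_classical_solution F x X \<Longrightarrow> global_classical_solution F y Y
    \<Longrightarrow> norm x \<le> r \<Longrightarrow> norm y \<le> r \<Longrightarrow> 0 \<le> t \<Longrightarrow> t \<le> T \<Longrightarrow> norm (X t - Y t) \<le> norm (x - y) * exp (L * t)"
proof -
  obtain L where L: "L \<ge> 0" "\<And>x y. norm x \<le> r * exp (C * T) \<Longrightarrow> norm y \<le> r * exp (C * T) \<Longrightarrow>
    norm (F x - F y) \<le> L * norm (x - y)"
    by (rule lipschitz_on_ballsE[OF lipschitz, of "r * exp (C * T)"]) blast
  show thesis
  proof (rule that[of L])
    fix x y X Y t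
    assume X: "global_classical_solution F x X" and Y: "global_classical_solution F y Y"
      and r: "norm x \<le> r" "norm y \<le> r" and t: "0 \<le> t" "t \<le> (T::real)"
    have bound: "norm (Z s) \<le> r * exp (C * T)"
      if "global_classical_solution F z Z" "norm z \<le> r" "0 \<le> s" "s \<le> T" for z Z s
    proof -
      have "norm (Z s) \<le> norm z * exp (C * s)" by (rule solution_norm_le) fact+
      also have "\<dots> \<le> r * exp (C * T)"
        using that C_nonneg order_trans[OF norm_ge_zero that(2)]
        by (intro mult_mono) (auto intro: mult_left_mono)
      finally show ?thesis .
    qed
    have "norm (X t - Y t) \<le> norm (X 0 - Y 0) * exp (L * t)"
    proof (rule norm_le_exp_of_inner_le)
      show "((\<lambda>s. X s - Y s) has_vector_derivative (F (X s) - F (Y s))) (at s within {0..})" if "0 \<le> s" for s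
        using that X Y by (intro has_vector_derivative_diff solution_derivative)
      fix s assume s: "0 < s" "s < t"
      have "(X s - Y s) \<bullet> (F (X s) - F (Y s)) \<le> norm (X s - Y s) * norm (F (X s) - F (Y s))"
        by (rule norm_cauchy_schwarz)
      also have "\<dots> \<le> norm (X s - Y s) * (L * norm (X s - Y s))"
        using s t bound[OF X r(1), of s] bound[OF Y r(2), of s] by (intro mult_left_mono L) auto
      finally show "(X s - Y s) \<bullet> (F (X s) - F (Y s)) \<le> L * (norm (X s - Y s))\<^sup>2"
        by (simp add: power2_eq_square mult_ac)
    qed fact
    then show "norm (X t - Y t) \<le> norm (x - y) * exp (L * t)"
      using solution_initial X Y by blast
  qed
qed

lemma solution_unique:
  assumes X: "global_classical_solution F x X" and Y: "global_classical_solution F x Y" and "0 \<le> t"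
  shows "X t = Y t"
proof -
  obtain L where "\<And>x' y' X Y s. global_classical_solution F x' X \<Longrightarrow> global_classical_solution F y' Y
    \<Longrightarrow> norm x' \<le> norm x \<Longrightarrow> norm y' \<le> norm x \<Longrightarrow> 0 \<le> s \<Longrightarrow> s \<le> t
    \<Longrightarrow> norm (X s - Y s) \<le> norm (x' - y') * exp (L * s)"
    by (rule solutions_dist_le[where r = "norm x" and T = t]) blast
  from this[OF X Y order_refl order_refl \<open>0 \<le> t\<close> order_refl] show ?thesis by simp
qed

section \<open>Picard iteration on the whole half-line\<close>

primrec picard :: "'a \<Rightarrow> nat \<Rightarrow> real \<Rightarrow> 'a" where
  "picard x 0 = (\<lambda>t. x)"
| "picard x (Suc k) = (\<lambda>t. x + integral {0..t} (\<lambda>s. F (picard x k s)))"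

lemma continuous_on_field: "continuous_on S f \<Longrightarrow> continuous_on S (\<lambda>s. F (f s))"
  by (rule continuous_on_compose2[OF lipschitz_on_balls_continuous[OF lipschitz]]) auto

lemma picard_continuous: "continuous_on {0..T} (picard x k)"
proof (induction k)
  case (Suc k)
  then show ?case
    by (auto intro!: continuous_intros indefinite_integral_continuous_1 integrable_continuous_real
        continuous_on_field)
qed simp

lemma picard_integrable: "(\<lambda>s. F (picard x k s)) integrable_on {0..t}"
  by (intro integrable_continuous_real continuous_on_field picard_continuous)

text \<open>The majorant \<open>m t = norm x * exp (C * t)\<close> solves the integral equation with
  \<open>C * m\<close> in place of the field, so one iteration step reproduces it exactly and the
  bound does not grow with \<open>k\<close>.\<close>

lemma picard_norm_le: "0 \<le> t \<Longrightarrow> norm (picard x k t) \<le> norm x * exp (C * t)"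
proof (induction k arbitrary: t)
  case 0
  then show ?case using C_nonneg by (simp add: mult_le_cancel_left1)
next
  case (Suc k)
  have I: "((\<lambda>s. norm x * (C * exp (C * s))) has_integral norm x * exp (C * t) - norm x * exp (C * 0)) {0..t}"
    using Suc.prems
    by (intro fundamental_theorem_of_calculus)
       (auto intro!: derivative_eq_intros simp flip: has_real_derivative_iff_has_vector_derivative)
  have "norm (integral {0..t} (\<lambda>s. F (picard x k s))) \<le> integral {0..t} (\<lambda>s. norm x * (C * exp (C * s)))"
  proof (rule integral_norm_bound_integral[OF picard_integrable])
    show "(\<lambda>s. norm x * (C * exp (C * s))) integrable_on {0..t}" using I by blast
    fix s assume "s \<in> {0..t}"
    then have "C * norm (picard x k s) \<le> C * (norm x * exp (C * s))"
      using C_nonneg by (intro mult_left_mono Suc.IH) auto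
    then show "norm (F (picard x k s)) \<le> norm x * (C * exp (C * s))"
      using growth[of "picard x k s"] by (simp add: mult_ac)
  qed
  also have "\<dots> = norm x * exp (C * t) - norm x" using integral_unique[OF I] by (simp del: integral_mult_right)
  finally show ?case
    using norm_triangle_ineq[of x "integral {0..t} (\<lambda>s. F (picard x k s))"] by simp
qed

lemma picard_norm_le_final:
  assumes "0 \<le> t" and "t \<le> T"
  shows "norm (picard x k t) \<le> norm x * exp (C * T)"
proof -
  have "norm (picard x k t) \<le> norm x * exp (C * t)" using assms(1) by (rule picard_norm_le)
  also have "\<dots> \<le> norm x * exp (C * T)" using assms C_nonneg by (intro mult_left_mono) (auto intro: mult_left_mono)
  finally show ?thesis .
qed

text \<open>The factor 2 is the triangle inequality for two iterates in the common ball; each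
  further integration contributes \<open>L * t / (k + 1)\<close>, which builds up the terms of an
  exponential series.\<close>

lemma picard_step_le:
  assumes "L \<ge> 0"
    and L: "\<And>y z. norm y \<le> norm x * exp (C * T) \<Longrightarrow> norm z \<le> norm x * exp (C * T) \<Longrightarrow>
      norm (F y - F z) \<le> L * norm (y - z)"
    and "0 \<le> t" "t \<le> T"
  shows "norm (picard x (Suc k) t - picard x k t) \<le> 2 * (norm x * exp (C * T)) * ((L * t) ^ k / fact k)"
  using \<open>0 \<le> t\<close> \<open>t \<le> T\<close>
proof (induction k arbitrary: t)
  case 0
  then show ?case
    using norm_triangle_ineq4[of "picard x (Suc 0) t" "picard x 0 t"]
      picard_norm_le_final[of t T x "Suc 0"] picard_norm_le_final[of t T x 0] by simp
next
  case (Suc k)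
  let ?M = "2 * (norm x * exp (C * T))"
  \<comment> \<open>The contribution at 0 vanishes because the exponent is \<open>Suc k\<close>,
    never 0.\<close>
  have I: "((\<lambda>s. L * (?M * ((L * s) ^ k / fact k))) has_integral
      ?M * ((L * t) ^ Suc k / fact (Suc k)) - ?M * ((L * 0) ^ Suc k / fact (Suc k))) {0..t}"
    using Suc.prems
  proof (intro fundamental_theorem_of_calculus)
    fix s
    have "((\<lambda>s. ?M * ((L * s) ^ Suc k / fact (Suc k))) has_real_derivative
        ?M * ((real (Suc k) * L * (L * s) ^ k) / fact (Suc k))) (at s within {0..t})"
      by (auto intro!: derivative_eq_intros simp: mult_ac simp del: fact_Suc power_Suc of_nat_Suc)
    also have "(real (Suc k) * L * (L * s) ^ k) / fact (Suc k) = L * ((L * s) ^ k / fact k)"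
      by (simp add: field_simps del: of_nat_Suc)
    finally show "((\<lambda>s. ?M * ((L * s) ^ Suc k / fact (Suc k))) has_vector_derivative
        L * (?M * ((L * s) ^ k / fact k))) (at s within {0..t})"
      by (simp only: has_real_derivative_iff_has_vector_derivative mult_ac)
  qed
  have "picard x (Suc (Suc k)) t - picard x (Suc k) t
      = integral {0..t} (\<lambda>s. F (picard x (Suc k) s)) - integral {0..t} (\<lambda>s. F (picard x k s))"
    by (simp only: picard.simps) simp
  also have "\<dots> = integral {0..t} (\<lambda>s. F (picard x (Suc k) s) - F (picard x k s))"
    by (intro integral_diff [symmetric] picard_integrable)
  also have "norm \<dots> \<le> integral {0..t} (\<lambda>s. L * (?M * ((L * s) ^ k / fact k)))"
  proof (rule integral_norm_bound_integral)
    show "(\<lambda>s. F (picard x (Suc k) s) - F (picard x k s)) integrable_on {0..t}"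
      by (intro integrable_diff picard_integrable)
    show "(\<lambda>s. L * (?M * ((L * s) ^ k / fact k))) integrable_on {0..t}" using I by blast
    fix s assume s: "s \<in> {0..t}"
    have "norm (F (picard x (Suc k) s) - F (picard x k s)) \<le> L * norm (picard x (Suc k) s - picard x k s)"
      using s Suc.prems by (intro L picard_norm_le_final) auto
    also have "\<dots> \<le> L * (?M * ((L * s) ^ k / fact k))"
      using s Suc.prems \<open>L \<ge> 0\<close> by (intro mult_left_mono Suc.IH) auto
    finally show "norm (F (picard x (Suc k) s) - F (picard x k s)) \<le> L * (?M * ((L * s) ^ k / fact k))" .
  qed
  also have "\<dots> = ?M * ((L * t) ^ Suc k / fact (Suc k))" using integral_unique[OF I] by (simp del: integral_mult_right)
  finally show ?case .
qed

text \<open>A telescoping series brings the Weierstrass test into play. As the sum is taken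
  pointwise and does not mention \<open>T\<close>, the limits on different intervals
  \<open>{0..T}\<close> agree without gluing.\<close>

definition picard_limit :: "'a \<Rightarrow> real \<Rightarrow> 'a" where
  "picard_limit x t = x + (\<Sum>k. picard x (Suc k) t - picard x k t)"

lemma picard_uniform_limit: "uniform_limit {0..T} (picard x) (picard_limit x) sequentially"
proof -
  obtain L where L: "L \<ge> 0" "\<And>y z. norm y \<le> norm x * exp (C * T) \<Longrightarrow> norm z \<le> norm x * exp (C * T) \<Longrightarrow>
      norm (F y - F z) \<le> L * norm (y - z)"
    by (rule lipschitz_on_ballsE[OF lipschitz, of "norm x * exp (C * T)"]) blast
  let ?M = "2 * (norm x * exp (C * T))"
  have "uniform_limit {0..T} (\<lambda>n t. \<Sum>k<n. picard x (Suc k) t - picard x k t)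
      (\<lambda>t. \<Sum>k. picard x (Suc k) t - picard x k t) sequentially"
  proof (rule Weierstrass_m_test)
    fix k t assume t: "t \<in> {0..T}"
    have "norm (picard x (Suc k) t - picard x k t) \<le> ?M * ((L * t) ^ k / fact k)"
      using t by (intro picard_step_le L) auto
    also have "\<dots> \<le> ?M * ((L * T) ^ k / fact k)"
      using t L(1) by (intro mult_left_mono divide_right_mono power_mono) auto
    finally show "norm (picard x (Suc k) t - picard x k t) \<le> ?M * ((L * T) ^ k / fact k)" .
  next
    show "summable (\<lambda>k. ?M * ((L * T) ^ k / fact k))"
      using summable_exp[of "L * T"] by (intro summable_mult) (simp add: field_simps)
  qed
  \<comment> \<open>Partial sums telescope back to the iterates, so convergence of the series is
    convergence of the iteration.\<close>
  moreover have "(\<Sum>k<n. picard x (Suc k) t - picard x k t) = picard x n t - x" for n t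
    using sum_lessThan_telescope[of "\<lambda>k. picard x k t" n] by simp
  ultimately have "uniform_limit {0..T} (\<lambda>n t. picard x n t - x)
      (\<lambda>t. \<Sum>k. picard x (Suc k) t - picard x k t) sequentially" by simp
  then have "uniform_limit {0..T} (\<lambda>n t. x + (picard x n t - x))
      (\<lambda>t. x + (\<Sum>k. picard x (Suc k) t - picard x k t)) sequentially"
    by (intro uniform_limit_intros)
  then show ?thesis by (simp add: picard_limit_def[abs_def])
qed

lemma picard_limit_norm_le:
  assumes "0 \<le> t" and "t \<le> T"
  shows "norm (picard_limit x t) \<le> norm x * exp (C * T)"
proof -
  have "(\<lambda>n. picard x n t) \<longlonglongrightarrow> picard_limit x t"
    using assms by (intro tendsto_uniform_limitI[OF picard_uniform_limit[where T = T]]) auto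
  then show ?thesis
    using assms by (intro tendsto_upperbound[OF tendsto_norm]) (auto intro!: always_eventually picard_norm_le_final)
qed

lemma picard_limit_continuous: "continuous_on {0..T} (picard_limit x)"
  by (rule uniform_limit_theorem[OF _ picard_uniform_limit]) (auto intro!: always_eventually picard_continuous)

text \<open>The iterates and their limit share one ball on \<open>{0..t}\<close>, so
  \<open>F\<close> preserves their uniform convergence there and the limit passes under the
  integral.\<close>

lemma picard_limit_integral_eq:
  assumes "0 \<le> t"
  shows "picard_limit x t = x + integral {0..t} (\<lambda>s. F (picard_limit x s))"
proof -
  obtain L where L: "L \<ge> 0" "\<And>y z. norm y \<le> norm x * exp (C * t) \<Longrightarrow> norm z \<le> norm x * exp (C * t) \<Longrightarrow>
      norm (F y - F z) \<le> L * norm (y - z)"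
    by (rule lipschitz_on_ballsE[OF lipschitz, of "norm x * exp (C * t)"]) blast
  have "uniform_limit {0..t} (\<lambda>n s. F (picard x n s)) (\<lambda>s. F (picard_limit x s)) sequentially"
  proof (rule uniform_limitI)
    fix e :: real assume "e > 0"
    \<comment> \<open>Dividing by \<open>L + 1\<close> covers \<open>L = 0\<close> and makes the
      final inequality strict.\<close>
    then have "e / (L + 1) > 0" using L(1) by simp
    then have "\<forall>\<^sub>F n in sequentially. \<forall>s\<in>{0..t}. dist (picard x n s) (picard_limit x s) < e / (L + 1)"
      by (rule uniform_limitD[OF picard_uniform_limit])
    then show "\<forall>\<^sub>F n in sequentially. \<forall>s\<in>{0..t}. dist (F (picard x n s)) (F (picard_limit x s)) < e"
    proof eventually_elim
      case (elim n)
      show ?case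
      proof
        fix s assume s: "s \<in> {0..t}"
        have "dist (F (picard x n s)) (F (picard_limit x s)) \<le> L * norm (picard x n s - picard_limit x s)"
          unfolding dist_norm using s by (intro L picard_norm_le_final picard_limit_norm_le) auto
        also have "\<dots> \<le> L * (e / (L + 1))"
          using elim s L(1) by (intro mult_left_mono) (auto simp: dist_norm less_imp_le)
        also have "\<dots> < e" using L(1) \<open>e > 0\<close> by (simp add: field_simps)
        finally show "dist (F (picard x n s)) (F (picard_limit x s)) < e" .
      qed
    qed
  qed
  then obtain I J where I: "\<And>n. ((\<lambda>s. F (picard x n s)) has_integral I n) {0..t}"
    and J: "((\<lambda>s. F (picard_limit x s)) has_integral J) {0..t}" and IJ: "I \<longlonglongrightarrow> J"
    by (rule uniform_limit_integral) (auto intro: continuous_on_field picard_continuous)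
  \<comment> \<open>The shifted iterates have two limits: the limit function itself and, by the
    recursion, \<open>x + J\<close>.\<close>
  have "(\<lambda>n. picard x (Suc n) t) \<longlonglongrightarrow> picard_limit x t"
    using assms
    by (intro LIMSEQ_Suc tendsto_uniform_limitI[OF picard_uniform_limit[where T = t]]) auto
  moreover have "(\<lambda>n. picard x (Suc n) t) \<longlonglongrightarrow> x + J"
    using tendsto_add[OF tendsto_const IJ] by (simp add: integral_unique[OF I])
  ultimately have "picard_limit x t = x + J" by (rule LIMSEQ_unique)
  then show ?thesis using J by (simp add: integral_unique)
qed

lemma picard_limit_solution: "global_classical_solution F x (picard_limit x)"
proof (rule solutionI)
  show "picard_limit x 0 = x" using picard_limit_integral_eq[of 0 x] by simp
  fix t :: real assume t: "0 \<le> t"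
  \<comment> \<open>The interval ends at \<open>t + 1\<close>, past \<open>t\<close>, so that near
    \<open>t\<close> it coincides with the half-line; this includes the one-sided case
    \<open>t = 0\<close>.\<close>
  have "((\<lambda>u. integral {0..u} (\<lambda>s. F (picard_limit x s))) has_vector_derivative F (picard_limit x t))
      (at t within {0..t + 1})"
    using t by (intro integral_has_vector_derivative continuous_on_field picard_limit_continuous) auto
  moreover have "at t within {0..t + 1} = at t within {0..}"
    by (rule at_within_nhd[of t "{..<t + 1}"]) auto
  ultimately have "((\<lambda>u. x + integral {0..u} (\<lambda>s. F (picard_limit x s))) has_vector_derivative F (picard_limit x t))
      (at t within {0..})"
    by (auto intro!: derivative_eq_intros)
  then show "(picard_limit x has_vector_derivative F (picard_limit x t)) (at t within {0..})"
    by (rule has_vector_derivative_transform[rotated 2]) (use t picard_limit_integral_eq in auto)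
qed

section \<open>The solution operator and its semiflow property\<close>

lemma solution_operator_eq:
  assumes "global_classical_solution F x X" and "0 \<le> t"
  shows "solution_operator F t x = X t"
  unfolding solution_operator_def using assms solution_unique by blast

text \<open>The equation is autonomous, so time translates of solutions are solutions; together with
  uniqueness this is the semigroup law.\<close>

lemma solution_shift:
  assumes X: "global_classical_solution F x X" and s: "0 \<le> s"
  shows "global_classical_solution F (X s) (\<lambda>t. X (t + s))"
proof (rule solutionI)
  fix t :: real assume t: "0 \<le> t"
  have "(X has_vector_derivative F (X (t + s))) (at (t + s) within (\<lambda>t. t + s) ` {0..})"
    using s t by (intro has_vector_derivative_within_subset[OF solution_derivative[OF X]]) auto
  moreover have "((\<lambda>t. t + s) has_vector_derivative 1) (at t within {0..})"
    by (auto intro!: derivative_eq_intros)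
  ultimately have "(X \<circ> (\<lambda>t. t + s) has_vector_derivative 1 *\<^sub>R F (X (t + s))) (at t within {0..})"
    by (intro vector_diff_chain_within)
  then show "((\<lambda>t. X (t + s)) has_vector_derivative F (X (t + s))) (at t within {0..})"
    by (simp add: o_def)
qed simp

text \<open>The increment is split through the trajectory of \<open>x0\<close> at the varying time
  \<open>t\<close>. The first part is controlled by dependence on initial data, with one
  \<open>L\<close> valid for all data and times within distance 1 of \<open>(t0, x0)\<close>; the
  second by continuity of a single trajectory.\<close>

lemma solution_operator_continuous:
  "continuous_on ({0..} \<times> UNIV) (\<lambda>(t, x). solution_operator F t x)"
  unfolding continuous_on_eq_continuous_within
proof (intro ballI)
  fix p0 :: "real \<times> 'a" assume p0: "p0 \<in> {0..} \<times> UNIV"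
  define t0 x0 where "t0 = fst p0" and "x0 = snd p0"
  have t0: "0 \<le> t0" and p0_eq: "p0 = (t0, x0)"
    using p0 by (auto simp: t0_def x0_def)
  define S where "S = solution_operator F"
  have S: "S t x = picard_limit x t" if "0 \<le> t" for t x
    unfolding S_def using that by (intro solution_operator_eq picard_limit_solution)
  obtain L where L: "\<And>x y X Y t. global_classical_solution F x X \<Longrightarrow> global_classical_solution F y Y
    \<Longrightarrow> norm x \<le> norm x0 + 1 \<Longrightarrow> norm y \<le> norm x0 + 1 \<Longrightarrow> 0 \<le> t \<Longrightarrow> t \<le> t0 + 1
    \<Longrightarrow> norm (X t - Y t) \<le> norm (x - y) * exp (L * t)"
    by (rule solutions_dist_le[where r = "norm x0 + 1" and T = "t0 + 1"]) blast
  let ?F = "at (t0, x0) within ({0..} \<times> UNIV)"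
  have tt: "(fst \<longlongrightarrow> t0) ?F" and tx: "(snd \<longlongrightarrow> x0) ?F"
    using tendsto_fst[OF tendsto_ident_at, of "(t0, x0)"] tendsto_snd[OF tendsto_ident_at, of "(t0, x0)"]
    by simp_all
  have nonneg: "\<forall>\<^sub>F p in ?F. 0 \<le> fst p"
    unfolding eventually_at_filter by (rule always_eventually) auto
  have "((\<lambda>p. picard_limit x0 (fst p)) \<longlongrightarrow> picard_limit x0 t0) ?F"
    by (rule continuous_on_tendsto_compose[OF solution_continuous[OF picard_limit_solution] tt]) (use t0 nonneg in simp_all)
  then have 1: "((\<lambda>p. norm (picard_limit x0 (fst p) - picard_limit x0 t0)) \<longlongrightarrow> 0) ?F"
    by (simp add: tendsto_norm_zero LIM_zero)
  have "((\<lambda>p. norm (snd p - x0) * exp (L * fst p)) \<longlongrightarrow> norm (x0 - x0) * exp (L * t0)) ?F"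
    by (intro tendsto_mult tendsto_norm tendsto_exp tendsto_diff tendsto_const tt tx)
  then have 2: "((\<lambda>p. norm (snd p - x0) * exp (L * fst p)) \<longlongrightarrow> 0) ?F" by simp
  have "\<forall>\<^sub>F p in ?F. dist (fst p) t0 < 1" "\<forall>\<^sub>F p in ?F. dist (snd p) x0 < 1"
    using tendstoD[OF tt, of 1] tendstoD[OF tx, of 1] by simp_all
  with nonneg have "\<forall>\<^sub>F p in ?F. norm ((case p of (t, x) \<Rightarrow> S t x) - S t0 x0)
      \<le> norm (snd p - x0) * exp (L * fst p) + norm (picard_limit x0 (fst p) - picard_limit x0 t0)"
  proof eventually_elim
    case (elim p)
    have "norm (snd p) \<le> norm x0 + 1" using elim norm_triangle_sub[of "snd p" x0] by (simp add: dist_norm)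
    then have "norm (picard_limit (snd p) (fst p) - picard_limit x0 (fst p)) \<le> norm (snd p - x0) * exp (L * fst p)"
      using elim by (intro L[OF picard_limit_solution picard_limit_solution]) (auto simp: dist_real_def)
    moreover have eq: "(case p of (t, x) \<Rightarrow> S t x) - S t0 x0
        = (picard_limit (snd p) (fst p) - picard_limit x0 (fst p)) + (picard_limit x0 (fst p) - picard_limit x0 t0)"
      using elim t0 by (simp add: S split_beta)
    ultimately show ?case
      unfolding eq using norm_triangle_ineq[of "picard_limit (snd p) (fst p) - picard_limit x0 (fst p)"
          "picard_limit x0 (fst p) - picard_limit x0 t0"] by linarith
  qed
  then have "((\<lambda>p. (case p of (t, x) \<Rightarrow> S t x) - S t0 x0) \<longlongrightarrow> 0) ?F"
    by (rule Lim_null_comparison) (use tendsto_add[OF 2 1] in simp)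
  then have "((\<lambda>(t, x). S t x) \<longlongrightarrow> S t0 x0) ?F" by (rule LIM_zero_cancel)
  then show "continuous (at p0 within {0..} \<times> UNIV) (\<lambda>(t, x). solution_operator F t x)"
    by (simp add: continuous_within S_def p0_eq)
qed

lemma solution_operator_semiflow: "continuous_semiflow (solution_operator F)"
  unfolding continuous_semiflow_def
proof (intro conjI allI impI ext solution_operator_continuous)
  show "solution_operator F 0 x = id x" for x
    using solution_operator_eq[OF picard_limit_solution, of 0 x]
      solution_initial[OF picard_limit_solution] by simp
  fix t s :: real and x :: 'a assume ts: "0 \<le> t" "0 \<le> s"
  have X: "global_classical_solution F x (picard_limit x)" by (rule picard_limit_solution)
  show "solution_operator F (t + s) x = (solution_operator F t \<circ> solution_operator F s) x"
    using solution_operator_eq[OF X] solution_operator_eq[OF solution_shift[OF X]] ts by simp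
qed

lemma unique_solution:
  "\<exists>X. global_classical_solution F x X \<and>
     (\<forall>Y. global_classical_solution F x Y \<longrightarrow> (\<forall>t\<ge>0. Y t = X t))"
  using picard_limit_solution solution_unique by blast

end

section \<open>The orthogonal projector onto a subspace\<close>

text \<open>Two candidates differ by an element of \<open>S\<close> that is orthogonal to all of
  \<open>S\<close>, in particular to itself.\<close>

lemma orth_projector_eqI:
  assumes S: "subspace S" and y: "y \<in> S" and orth: "\<And>z. z \<in> S \<Longrightarrow> orthogonal (x - y) z"
  shows "orth_projector S x = y"
  unfolding orth_projector_def
proof (rule the_equality)
  show "y \<in> S \<and> (\<forall>z\<in>S. orthogonal (x - y) z)" using y orth by blast
  fix y' assume y': "y' \<in> S \<and> (\<forall>z\<in>S. orthogonal (x - y') z)"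
  then have d: "y - y' \<in> S" using S y by (simp add: subspace_diff)
  then have "(x - y') \<bullet> (y - y') - (x - y) \<bullet> (y - y') = 0"
    using y' orth[OF d] by (simp add: orthogonal_def)
  then have "(y - y') \<bullet> (y - y') = 0" by (simp flip: inner_diff_left)
  then show "y' = y" by simp
qed

lemma orth_projector_mem:
  assumes S: "subspace S"
  shows "orth_projector S x \<in> S" and "z \<in> S \<Longrightarrow> orthogonal (x - orth_projector S x) z"
proof -
  obtain y w where y: "y \<in> span S" and w: "\<And>u. u \<in> span S \<Longrightarrow> orthogonal w u" and x: "x = y + w"
    by (rule orthogonal_subspace_decomp_exists) blast
  have [simp]: "span S = S" using S by (simp add: span_eq_iff)
  have "orth_projector S x = y"
    using y w x by (intro orth_projector_eqI[OF S]) auto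
  then show "orth_projector S x \<in> S" and "z \<in> S \<Longrightarrow> orthogonal (x - orth_projector S x) z"
    using y w x by simp_all
qed

text \<open>Sums and multiples of projections satisfy the characterizing conditions, which determine
  the projection.\<close>

lemma linear_orth_projector:
  assumes S: "subspace S"
  shows "linear (orth_projector S)"
proof (rule linearI)
  note mem = orth_projector_mem[OF S]
  show "orth_projector S (x + y) = orth_projector S x + orth_projector S y" for x y
  proof (rule orth_projector_eqI[OF S])
    fix z assume "z \<in> S"
    then have "orthogonal ((x - orth_projector S x) + (y - orth_projector S y)) z"
      by (intro orthogonal_clauses mem)
    then show "orthogonal (x + y - (orth_projector S x + orth_projector S y)) z"
      by (simp add: algebra_simps)
  qed (intro subspace_add S mem)
  show "orth_projector S (c *\<^sub>R x) = c *\<^sub>R orth_projector S x" for c x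
  proof (rule orth_projector_eqI[OF S])
    fix z assume "z \<in> S"
    then have "orthogonal (c *\<^sub>R (x - orth_projector S x)) z"
      by (intro orthogonal_clauses mem)
    then show "orthogonal (c *\<^sub>R x - c *\<^sub>R orth_projector S x) z"
      by (simp add: algebra_simps)
  qed (intro subspace_scale S mem)
qed

lemma subspace_null_space: "subspace (null_space E :: (real^'d^'n) set)"
proof -
  let ?f = "\<lambda>c. (\<chi> v. null_vector E $ v *\<^sub>R c) :: real^'d^'n"
  have "linear ?f" by (rule linearI) (simp_all add: vec_eq_iff algebra_simps)
  then have "subspace (range ?f)" by (rule linear_subspace_image) simp
  moreover have "(null_space E :: (real^'d^'n) set) = range ?f" by (auto simp: null_space_def)
  ultimately show ?thesis by simp
qed

lemma bounded_linear_Q_proj: "bounded_linear (Q_proj E)"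
  unfolding Q_proj_def[abs_def]
  by (intro bounded_linear_sub bounded_linear_ident)
     (simp flip: linear_conv_bounded_linear add: linear_orth_projector subspace_null_space)

section \<open>The attention matrix\<close>

lemma lipschitz_on_balls_leaky_relu:
  assumes "0 < \<alpha>" and "\<alpha> < 1"
  shows "lipschitz_on_balls (leaky_relu \<alpha>)"
proof (rule lipschitz_on_ballsI)
  \<comment> \<open>For arguments of opposite sign, damping the negative one moves it towards 0 and
    hence towards the other.\<close>
  have mixed: "\<bar>x - \<alpha> * y\<bar> \<le> \<bar>x - y\<bar>" if "0 \<le> x" "y < 0" for x y
  proof -
    have "y \<le> \<alpha> * y" "\<alpha> * y \<le> 0"
      using that assms by (simp_all add: mult_le_cancel_right2 mult_nonneg_nonpos)
    then show ?thesis using that by linarith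
  qed
  have "norm (leaky_relu \<alpha> x - leaky_relu \<alpha> y) \<le> 1 * norm (x - y)" for x y
  proof (cases "0 \<le> x"; cases "0 \<le> y")
    assume "\<not> 0 \<le> x" "\<not> 0 \<le> y"
    moreover have "\<bar>\<alpha> * x - \<alpha> * y\<bar> = \<alpha> * \<bar>x - y\<bar>"
      using assms by (simp add: abs_mult flip: right_diff_distrib)
    ultimately show ?thesis using assms by (simp add: leaky_relu_def mult_left_le_one_le)
  qed (use mixed[of x y] mixed[of y x] in \<open>auto simp: leaky_relu_def abs_minus_commute\<close>)
  then show "\<exists>L. \<forall>x y. norm x \<le> r \<longrightarrow> norm y \<le> r \<longrightarrow>
      norm (leaky_relu \<alpha> x - leaky_relu \<alpha> y) \<le> L * norm (x - y)" for r by blast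
qed

lemma lipschitz_on_balls_exp: "lipschitz_on_balls (exp :: real \<Rightarrow> real)"
  by (rule lipschitz_on_balls_C1[OF DERIV_exp]) (intro continuous_intros)

lemma lipschitz_on_balls_tanh: "lipschitz_on_balls (tanh :: real \<Rightarrow> real)"
  by (rule lipschitz_on_balls_C1[where f' = "\<lambda>x. 1 - tanh x ^ 2"])
     (auto intro!: derivative_eq_intros continuous_intros)

text \<open>The difference of inverses is that of the values divided by \<open>f x * f y\<close>,
  which is at least 1.\<close>

lemma lipschitz_on_balls_inverse:
  fixes f :: "'a::real_normed_vector \<Rightarrow> real"
  assumes "lipschitz_on_balls f" and "\<And>x. 1 \<le> f x"
  shows "lipschitz_on_balls (\<lambda>x. inverse (f x))"
proof (rule lipschitz_on_ballsI)
  fix r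
  obtain L where L: "\<And>x y. norm x \<le> r \<Longrightarrow> norm y \<le> r \<Longrightarrow> norm (f x - f y) \<le> L * norm (x - y)"
    by (rule lipschitz_on_ballsE[OF assms(1), of r]) blast
  have "norm (inverse (f x) - inverse (f y)) \<le> norm (f x - f y)" for x y
  proof -
    have pos: "1 \<le> f x" "1 \<le> f y" using assms(2) by auto
    then have "norm (inverse (f x) - inverse (f y)) = \<bar>f x - f y\<bar> / (f x * f y)"
      by (simp add: field_simps abs_minus_commute)
    also have "\<dots> \<le> \<bar>f x - f y\<bar> / 1"
      using pos mult_mono[of 1 "f x" 1 "f y"] by (intro divide_left_mono) auto
    finally show ?thesis by simp
  qed
  then show "\<exists>L. \<forall>x y. norm x \<le> r \<longrightarrow> norm y \<le> r \<longrightarrow>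
      norm (inverse (f x) - inverse (f y)) \<le> L * norm (x - y)" using L order_trans by blast
qed

text \<open>The denominator on the right contains the summand \<open>exp 0 = 1\<close>, so inversion is Lipschitz on its range.\<close>

lemma softmax_eq_inverse:
  fixes s :: "'i \<Rightarrow> real"
  shows "exp (s i) / (\<Sum>j\<in>I. exp (s j)) = inverse (\<Sum>j\<in>I. exp (s j - s i))"
  by (simp add: exp_diff flip: sum_divide_distrib)

lemma lipschitz_on_balls_softmax:
  fixes s :: "'i \<Rightarrow> 'a::real_normed_vector \<Rightarrow> real"
  assumes "\<And>j. j \<in> I \<Longrightarrow> lipschitz_on_balls (s j)" and "finite I" and "i \<in> I"
  shows "lipschitz_on_balls (\<lambda>x. exp (s i x) / (\<Sum>j\<in>I. exp (s j x)))"
  unfolding softmax_eq_inverse[of "\<lambda>j. s j _"]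
proof (rule lipschitz_on_balls_inverse)
  show "lipschitz_on_balls (\<lambda>x. \<Sum>j\<in>I. exp (s j x - s i x))"
    using assms
    by (intro lipschitz_on_balls_sum lipschitz_on_balls_compose[OF lipschitz_on_balls_exp]
        lipschitz_on_balls_diff)
  show "1 \<le> (\<Sum>j\<in>I. exp (s j x - s i x))" for x
    using member_le_sum[of i I "\<lambda>j. exp (s j x - s i x)"] assms by simp
qed

section \<open>Regularity and uniform bounds of the attention weights\<close>

context
  fixes E :: "('n::finite) set set" and \<epsilon> \<alpha> :: real and \<rho> :: "real \<Rightarrow> real"
    and \<theta> :: "('d::finite + 'd) mlp_params" and Agg :: "(real^'d) multiset \<Rightarrow> real^'d"
  assumes \<epsilon>: "0 < \<epsilon>" "\<epsilon> < 1" and \<alpha>: "0 < \<alpha>" "\<alpha> < 1"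
    and mlp: "locally_lipschitz (mlp \<rho> \<theta>)"
    and Agg: "locally_lipschitz_aggregator TYPE('n) Agg"
    and nonempty: "\<And>e. e \<in> E \<Longrightarrow> e \<noteq> {}"
begin

lemma lipschitz_on_balls_edge_feature:
  "e \<in> E \<Longrightarrow> lipschitz_on_balls (\<lambda>X::real^'d^'n. edge_feature Agg X e)"
  using Agg nonempty unfolding locally_lipschitz_aggregator_def
  by (intro locally_lipschitz_imp_lipschitz_on_balls) blast

lemma lipschitz_on_balls_attention_score:
  assumes "e \<in> E"
  shows "lipschitz_on_balls (\<lambda>X::real^'d^'n. attention_score \<alpha> \<rho> \<theta> Agg X e v)"
  unfolding attention_score_def
proof (intro lipschitz_on_balls_compose[OF lipschitz_on_balls_leaky_relu[OF \<alpha>]]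
    lipschitz_on_balls_compose[OF locally_lipschitz_imp_lipschitz_on_balls[OF mlp]] lipschitz_on_balls_vec)
  fix i :: "'d + 'd"
  show "lipschitz_on_balls (\<lambda>X::real^'d^'n. vec_concat (X $ v) (edge_feature Agg X e) $ i)"
  proof (cases i)
    case (Inl j)
    have "bounded_linear (\<lambda>X::real^'d^'n. X $ v $ j)"
      by (intro bounded_linear_compose[OF bounded_linear_vec_nth] bounded_linear_vec_nth)
    then show ?thesis by (simp add: Inl vec_concat_def lipschitz_on_balls_linear)
  next
    case (Inr j)
    have "lipschitz_on_balls (\<lambda>X::real^'d^'n. edge_feature Agg X e $ j)"
      by (intro lipschitz_on_balls_compose[OF lipschitz_on_balls_linear[OF bounded_linear_vec_nth]]
          lipschitz_on_balls_edge_feature assms)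
    then show ?thesis by (simp add: Inr vec_concat_def)
  qed
qed

lemma lipschitz_on_balls_attention_weight:
  assumes "e \<in> E" and "v \<in> e"
  shows "lipschitz_on_balls (\<lambda>X::real^'d^'n. attention_weight E \<epsilon> \<alpha> \<rho> \<theta> Agg X e v)"
  unfolding attention_weight_def
  using assms
  by (intro lipschitz_on_balls_add lipschitz_on_balls_const
      lipschitz_on_balls_linear[OF bounded_linear_mult_right, THEN lipschitz_on_balls_compose]
      lipschitz_on_balls_softmax lipschitz_on_balls_attention_score) auto

text \<open>Padded and off-diagonal entries are constantly 0; at incident pairs the softmax sum
  contains the edge itself, as its regularity requires.\<close>

lemma lipschitz_on_balls_attention_matrix:
  "lipschitz_on_balls (\<lambda>X::real^'d^'n. attention_matrix E \<epsilon> \<alpha> \<rho> \<theta> Agg X)"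
proof (intro lipschitz_on_balls_vec)
  fix i j :: "'n set \<times> 'n"
  show "lipschitz_on_balls (\<lambda>X::real^'d^'n. attention_matrix E \<epsilon> \<alpha> \<rho> \<theta> Agg X $ i $ j)"
  proof (cases "i = j \<and> i \<in> incidences E")
    case True
    then show ?thesis
      by (auto simp: attention_matrix_def diag_matrix_def incidences_def
          intro: lipschitz_on_balls_attention_weight)
  next
    case False
    then have "attention_matrix E \<epsilon> \<alpha> \<rho> \<theta> Agg X $ i $ j = 0" for X :: "real^'d^'n"
      by (auto simp: attention_matrix_def diag_matrix_def)
    then show ?thesis by (simp add: lipschitz_on_balls_const)
  qed
qed

text \<open>The weight is a convex combination, with coefficients \<open>1 - \<epsilon>\<close> and
  \<open>\<epsilon>\<close>, of a softmax share and the reciprocal degree, both in the unit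
  interval.\<close>

lemma abs_attention_weight_le:
  fixes X :: "real^'d^'n"
  assumes "e \<in> E" and "v \<in> e"
  shows "\<bar>attention_weight E \<epsilon> \<alpha> \<rho> \<theta> Agg X e v\<bar> \<le> 1"
proof -
  let ?s = "\<lambda>e. exp (attention_score \<alpha> \<rho> \<theta> Agg X e v)"
  define w where "w = ?s e / (\<Sum>e' | e' \<in> E \<and> v \<in> e'. ?s e')"
  define c where "c = \<epsilon> / real (hg_degree E v)"
  have "?s e \<le> (\<Sum>e' | e' \<in> E \<and> v \<in> e'. ?s e')"
    using assms by (intro member_le_sum) auto
  then have w: "0 \<le> w" "w \<le> 1"
    unfolding w_def by (auto intro!: sum_nonneg divide_nonneg_nonneg simp: divide_le_eq_1)
      (meson exp_gt_zero less_le_trans order.asym)+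
  \<comment> \<open>The edge \<open>e\<close> itself contains \<open>v\<close>.\<close>
  have "hg_degree E v \<ge> 1"
    using assms by (auto simp: hg_degree_def Suc_le_eq card_gt_0_iff)
  then have c: "0 \<le> c" "c \<le> \<epsilon>"
    unfolding c_def using \<epsilon> by (auto simp: divide_le_eq)
  have "0 \<le> (1 - \<epsilon>) * w" "(1 - \<epsilon>) * w \<le> 1 - \<epsilon>"
    using w \<epsilon> by (simp_all add: mult_left_le)
  then have "\<bar>(1 - \<epsilon>) * w + c\<bar> \<le> 1" using c by (simp add: abs_le_iff)
  then show ?thesis unfolding attention_weight_def w_def c_def .
qed

text \<open>The witness merely counts matrix entries; what matters for linear growth is its
  independence of \<open>X\<close>.\<close>

lemma bounded_attention_matrix:
  obtains B where "\<And>X::real^'d^'n. norm (attention_matrix E \<epsilon> \<alpha> \<rho> \<theta> Agg X) \<le> B"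
proof
  fix X :: "real^'d^'n"
  let ?A = "attention_matrix E \<epsilon> \<alpha> \<rho> \<theta> Agg X"
  have entry: "norm (?A $ i $ j) \<le> 1" for i j
    using abs_attention_weight_le[of "fst i" "snd i" X]
    by (auto simp: attention_matrix_def diag_matrix_def incidences_def)
  have "norm (?A $ i) \<le> (\<Sum>j\<in>(UNIV::('n set \<times> 'n) set). 1)" for i
    by (rule order_trans[OF norm_le_sum_norm_nth sum_mono]) (rule entry)
  then show "norm ?A \<le> (\<Sum>i\<in>(UNIV::('n set \<times> 'n) set). \<Sum>j\<in>(UNIV::('n set \<times> 'n) set). 1)"
    by (rule order_trans[OF norm_le_sum_norm_nth sum_mono])
qed

end

section \<open>The vector field\<close>

lemma bounded_bilinear_matrix_mult:
  "bounded_bilinear ((**) :: real^'n^'m \<Rightarrow> real^'p^'n \<Rightarrow> real^'p^'m)"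
  unfolding bilinear_conv_bounded_bilinear[symmetric] bilinear_def
  by (auto intro!: linearI simp: matrix_matrix_mult_def vec_eq_iff sum.distrib sum_distrib_left algebra_simps)

text \<open>Multiplied by \<open>norm z\<close>, the difference of directions equals
  \<open>z - w\<close> plus \<open>(norm w - norm z) *\<^sub>R sgn w\<close>; each part has norm at
  most \<open>norm (z - w)\<close>. With \<open>sgn 0 = 0\<close> this also covers zero
  vectors.\<close>

lemma norm_mult_sgn_diff_le:
  fixes z w :: "'a::real_normed_vector"
  shows "norm z * norm (sgn z - sgn w) \<le> 2 * norm (z - w)"
proof -
  have *: "norm x *\<^sub>R sgn x = x" for x :: 'a by (cases "x = 0") (simp_all add: sgn_div_norm)
  have "norm z *\<^sub>R (sgn z - sgn w) = (z - w) + (norm w - norm z) *\<^sub>R sgn w"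
    by (simp add: scaleR_diff_right scaleR_diff_left *)
  then have "norm z * norm (sgn z - sgn w) = norm ((z - w) + (norm w - norm z) *\<^sub>R sgn w)"
    by (metis norm_scaleR abs_norm_cancel)
  also have "\<dots> \<le> norm (z - w) + \<bar>norm w - norm z\<bar> * norm (sgn w)"
    using norm_triangle_ineq[of "z - w" "(norm w - norm z) *\<^sub>R sgn w"] by simp
  also have "\<bar>norm w - norm z\<bar> * norm (sgn w) \<le> norm (z - w) * 1"
    using norm_triangle_ineq3[of w z]
    by (intro mult_mono) (auto simp: norm_sgn norm_minus_commute)
  finally show ?thesis by simp
qed

text \<open>The quotient in the reaction term is singular at \<open>Q x = 0\<close>. It depends on \<open>Q x\<close> only through the
  direction \<open>sgn (Q x)\<close>, and the factor \<open>Q x\<close> compensates for the singularity of \<open>sgn\<close>.\<close>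

lemma lipschitz_on_balls_scaleR_sgn:
  fixes p :: "'b::real_normed_vector \<times> 'c::real_normed_vector \<Rightarrow> real" and A :: "'a::real_normed_vector \<Rightarrow> 'b"
  assumes p: "lipschitz_on_balls p" and A: "lipschitz_on_balls A" and Q: "lipschitz_on_balls Q"
  shows "lipschitz_on_balls (\<lambda>x. p (A x, sgn (Q x)) *\<^sub>R Q x)"
proof (rule lipschitz_on_ballsI)
  fix r
  obtain a where a: "a \<ge> 0" "\<And>x. norm x \<le> r \<Longrightarrow> norm (A x) \<le> a"
    using lipschitz_on_balls_bound[OF A] by metis
  obtain k where k: "k \<ge> 0" "\<And>x. norm x \<le> r \<Longrightarrow> norm (Q x) \<le> k"
    using lipschitz_on_balls_bound[OF Q] by metis
  obtain L where L: "L \<ge> 0" "\<And>x y. norm x \<le> r \<Longrightarrow> norm y \<le> r \<Longrightarrow> norm (A x - A y) \<le> L * norm (x - y)"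
    by (rule lipschitz_on_ballsE[OF A, of r]) blast
  obtain K where K: "K \<ge> 0" "\<And>x y. norm x \<le> r \<Longrightarrow> norm y \<le> r \<Longrightarrow> norm (Q x - Q y) \<le> K * norm (x - y)"
    by (rule lipschitz_on_ballsE[OF Q, of r]) blast
  \<comment> \<open>The radius \<open>a + 1\<close> bounds the pair formed by \<open>A x\<close> and
    a direction, whose norm is at most 1.\<close>
  obtain M where M: "M \<ge> 0" "\<And>x y. norm x \<le> a + 1 \<Longrightarrow> norm y \<le> a + 1 \<Longrightarrow> norm (p x - p y) \<le> M * norm (x - y)"
    by (rule lipschitz_on_ballsE[OF p, of "a + 1"]) blast
  obtain b where b: "b \<ge> 0" "\<And>x. norm x \<le> a + 1 \<Longrightarrow> norm (p x) \<le> b"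
    using lipschitz_on_balls_bound[OF p] by metis
  define s where "s x = (A x, sgn (Q x))" for x
  have s: "norm (s x) \<le> a + 1" if "norm x \<le> r" for x
    unfolding s_def by (rule order_trans[OF norm_Pair_le add_mono[OF a(2)[OF that]]]) (simp add: norm_sgn)
  have "norm (p (s x) *\<^sub>R Q x - p (s y) *\<^sub>R Q y) \<le> (M * (L * k + 2 * K) + b * K) * norm (x - y)"
    if xy: "norm x \<le> r" "norm y \<le> r" for x y
  proof -
    have "norm (s x - s y) \<le> norm (A x - A y) + norm (sgn (Q x) - sgn (Q y))"
      unfolding s_def by (simp add: norm_Pair_le)
    then have "norm (s x - s y) * norm (Q x)
        \<le> norm (A x - A y) * norm (Q x) + norm (Q x) * norm (sgn (Q x) - sgn (Q y))"
      using mult_right_mono[of _ _ "norm (Q x)"] by (fastforce simp: algebra_simps)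
    also have "\<dots> \<le> (L * norm (x - y)) * k + 2 * norm (Q x - Q y)"
      using L k xy by (intro add_mono mult_mono norm_mult_sgn_diff_le) auto
    also have "\<dots> \<le> (L * norm (x - y)) * k + 2 * (K * norm (x - y))"
      using K(2)[OF xy] by simp
    finally have 1: "norm (s x - s y) * norm (Q x) \<le> (L * k + 2 * K) * norm (x - y)"
      by (simp add: algebra_simps)
    \<comment> \<open>The splitting places \<open>Q x\<close> next to the difference of the
      \<open>p\<close> values, matching the weight \<open>norm (Q x)\<close> in estimate
      \<open>1\<close>.\<close>
    have "p (s x) *\<^sub>R Q x - p (s y) *\<^sub>R Q y = (p (s x) - p (s y)) *\<^sub>R Q x + p (s y) *\<^sub>R (Q x - Q y)"
      by (simp add: algebra_simps)
    then have "norm (p (s x) *\<^sub>R Q x - p (s y) *\<^sub>R Q y)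
        \<le> norm (p (s x) - p (s y)) * norm (Q x) + norm (p (s y)) * norm (Q x - Q y)"
      using norm_triangle_ineq[of "(p (s x) - p (s y)) *\<^sub>R Q x" "p (s y) *\<^sub>R (Q x - Q y)"] by simp
    also have "\<dots> \<le> (M * norm (s x - s y)) * norm (Q x) + b * (K * norm (x - y))"
      using M K b s xy by (intro add_mono mult_mono) auto
    also have "\<dots> = M * (norm (s x - s y) * norm (Q x)) + b * (K * norm (x - y))" by simp
    also have "\<dots> \<le> M * ((L * k + 2 * K) * norm (x - y)) + b * (K * norm (x - y))"
      using 1 M(1) by (intro add_right_mono mult_left_mono)
    finally show ?thesis by (simp add: algebra_simps)
  qed
  then show "\<exists>L. \<forall>x y. norm x \<le> r \<longrightarrow> norm y \<le> r \<longrightarrow>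
      norm (p (A x, sgn (Q x)) *\<^sub>R Q x - p (A y, sgn (Q y)) *\<^sub>R Q y) \<le> L * norm (x - y)"
    unfolding s_def by blast
qed

text \<open>Only the numerator of the quotient: at a unit vector the denominator is 1. Keeping the
  attention matrix as a separate argument makes this a cubic polynomial, free of
  singularities.\<close>

definition rayleigh :: "real^'n^'m \<Rightarrow> (real^'m^'m) \<times> (real^'d^'n) \<Rightarrow> real" where
  "rayleigh G p = (G ** snd p) \<bullet> (fst p ** (G ** snd p))"

lemma lipschitz_on_balls_rayleigh:
  "lipschitz_on_balls (rayleigh G :: (real^'m^'m) \<times> (real^'d^'n) \<Rightarrow> real)"
proof -
  note mult = lipschitz_on_balls_bilinear[OF bounded_bilinear_matrix_mult]
  show ?thesis
    unfolding rayleigh_def[abs_def]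
    by (intro lipschitz_on_balls_bilinear[OF bounded_bilinear_inner] mult lipschitz_on_balls_const
        lipschitz_on_balls_linear bounded_linear_fst bounded_linear_snd)
qed

text \<open>Quadratic homogeneity absorbs the squared norm into \<open>sgn\<close>. Where the
  projection vanishes, the factor \<open>Q_proj E X\<close> makes both sides 0.\<close>

lemma reaction_quotient_scaleR:
  "reaction_quotient E \<omega> \<epsilon> \<alpha> \<rho> \<theta> Agg X *\<^sub>R Q_proj E X =
   rayleigh (gradient_matrix E \<omega>) (attention_matrix E \<epsilon> \<alpha> \<rho> \<theta> Agg X, sgn (Q_proj E X)) *\<^sub>R Q_proj E X"
proof (cases "Q_proj E X = 0")
  case False
  then show ?thesis
    by (simp add: reaction_quotient_def Let_def rayleigh_def sgn_div_norm
        bounded_bilinear.scaleR_right[OF bounded_bilinear_matrix_mult] field_simps power2_eq_square)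
qed simp

text \<open>The squared norm appears as an inner product so that the rule for bilinear maps applies
  to it.\<close>

lemma hnrd_field_eq:
  "hnrd_field E \<omega> \<epsilon> \<alpha> \<rho> \<theta> Agg \<eta> X =
     - (transpose (gradient_matrix E \<omega>) **
          (attention_matrix E \<epsilon> \<alpha> \<rho> \<theta> Agg X ** (gradient_matrix E \<omega> ** X)))
     + (rayleigh (gradient_matrix E \<omega>) (attention_matrix E \<epsilon> \<alpha> \<rho> \<theta> Agg X, sgn (Q_proj E X)) *\<^sub>R Q_proj E X
        + tanh (softplus \<eta> - Q_proj E X \<bullet> Q_proj E X) *\<^sub>R Q_proj E X)"
  by (simp add: hnrd_field_def reaction_term_def scaleR_left_distrib reaction_quotient_scaleR dot_square_norm)

lemma linear_growth_field_hnrd: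
  fixes E :: "('n::finite) set set" and \<theta> :: "('d::finite + 'd) mlp_params"
  assumes \<epsilon>: "0 < \<epsilon>" "\<epsilon> < 1" and \<alpha>: "0 < \<alpha>" "\<alpha> < 1"
    and mlp: "locally_lipschitz (mlp \<rho> \<theta>)"
    and Agg: "locally_lipschitz_aggregator TYPE('n) Agg"
    and nonempty: "\<And>e. e \<in> E \<Longrightarrow> e \<noteq> {}"
  obtains C where "linear_growth_field (hnrd_field E \<omega> \<epsilon> \<alpha> \<rho> \<theta> Agg \<eta> :: real^'d^'n \<Rightarrow> real^'d^'n) C"
proof -
  let ?F = "hnrd_field E \<omega> \<epsilon> \<alpha> \<rho> \<theta> Agg \<eta> :: real^'d^'n \<Rightarrow> real^'d^'n"
  let ?G = "gradient_matrix E \<omega>"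
  let ?A = "attention_matrix E \<epsilon> \<alpha> \<rho> \<theta> Agg :: real^'d^'n \<Rightarrow> _"
  let ?Q = "Q_proj E :: real^'d^'n \<Rightarrow> real^'d^'n"
  define p where "p X = rayleigh ?G (?A X, sgn (?Q X))" for X
  note mult = lipschitz_on_balls_bilinear[OF bounded_bilinear_matrix_mult]
  note A = lipschitz_on_balls_attention_matrix[OF assms]
  note Q = lipschitz_on_balls_linear[OF bounded_linear_Q_proj]
  have lip: "lipschitz_on_balls ?F"
    unfolding hnrd_field_eq
    by (intro lipschitz_on_balls_add lipschitz_on_balls_minus lipschitz_on_balls_scaleR_sgn
        lipschitz_on_balls_rayleigh A Q mult lipschitz_on_balls_const
        lipschitz_on_balls_linear[OF bounded_linear_ident]
        lipschitz_on_balls_bilinear[OF bounded_bilinear_scaleR]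
        lipschitz_on_balls_bilinear[OF bounded_bilinear_inner]
        lipschitz_on_balls_compose[OF lipschitz_on_balls_tanh] lipschitz_on_balls_diff)
  obtain a where a: "\<And>X. norm (?A X) \<le> a"
    using bounded_attention_matrix[OF assms] by metis
  \<comment> \<open>The argument of \<open>rayleigh\<close> stays in one ball for all
    \<open>X\<close>, so boundedness on balls gives a global bound \<open>b\<close>.\<close>
  have "norm (?A X, sgn (?Q X)) \<le> a + 1" for X
    by (rule order_trans[OF norm_Pair_le add_mono[OF a]]) (simp add: norm_sgn)
  then obtain b where b: "\<And>X. \<bar>p X\<bar> \<le> b"
    using lipschitz_on_balls_bound[OF lipschitz_on_balls_rayleigh[of ?G], of "a + 1"]
    unfolding p_def by (metis real_norm_def)
  obtain k where k: "k > 0" "\<And>X. norm (?Q X) \<le> norm X * k"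
    using bounded_linear.pos_bounded[OF bounded_linear_Q_proj] by blast
  have "bounded_bilinear (\<lambda>(B::real^('n set \<times> 'n)^('n set \<times> 'n)) (X::real^'d^'n). B ** (?G ** X))"
    by (rule bounded_bilinear.comp[OF bounded_bilinear_matrix_mult bounded_linear_ident])
       (rule bounded_bilinear.bounded_linear_right[OF bounded_bilinear_matrix_mult])
  then obtain m where m: "m > 0" "\<And>(B::real^('n set \<times> 'n)^('n set \<times> 'n)) (X::real^'d^'n). norm (B ** (?G ** X)) \<le> norm B * norm X * m"
    using bounded_bilinear.pos_bounded by blast
  obtain l where l: "l > 0" "\<And>Y. norm (transpose ?G ** Y :: real^'d^'n) \<le> norm Y * l"
    using bounded_linear.pos_bounded[OF bounded_bilinear.bounded_linear_right[OF bounded_bilinear_matrix_mult]]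
    by blast
  have "a \<ge> 0" using a norm_ge_zero order_trans by blast
  have "b \<ge> 0" using b abs_ge_zero order_trans by blast
  \<comment> \<open>Diffusion contributes \<open>a * m * l\<close>, the Rayleigh term
    \<open>b * k\<close>, and the remaining reaction \<open>1 * k\<close> since \<open>tanh\<close>
    is bounded by 1.\<close>
  have "norm (?F X) \<le> (a * m * l + (b + 1) * k) * norm X" for X
  proof -
    have "norm (transpose ?G ** (?A X ** (?G ** X))) \<le> norm (?A X ** (?G ** X)) * l" by (rule l)
    also have "\<dots> \<le> (a * norm X * m) * l"
      using l m a by (intro mult_right_mono order_trans[OF m(2)]) (auto intro!: mult_right_mono)
    finally have 1: "norm (transpose ?G ** (?A X ** (?G ** X))) \<le> a * norm X * m * l" .
    have "norm (p X *\<^sub>R ?Q X) \<le> b * (norm X * k)"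
      unfolding norm_scaleR using b k \<open>b \<ge> 0\<close> by (intro mult_mono) auto
    moreover have "norm (tanh (softplus \<eta> - ?Q X \<bullet> ?Q X) *\<^sub>R ?Q X) \<le> 1 * (norm X * k)"
      unfolding norm_scaleR using k tanh_real_bounds[of "softplus \<eta> - ?Q X \<bullet> ?Q X"]
      by (intro mult_mono) auto
    ultimately have "norm (?F X) \<le> a * norm X * m * l + (b * (norm X * k) + 1 * (norm X * k))"
      unfolding hnrd_field_eq p_def[symmetric]
      by (intro norm_triangle_le add_mono order_trans[OF norm_triangle_ineq]) (use 1 in simp_all)
    then show ?thesis by (simp add: algebra_simps)
  qed
  moreover have "0 \<le> a * m * l + (b + 1) * k"
    using \<open>a \<ge> 0\<close> \<open>b \<ge> 0\<close> k m l by simp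
  ultimately show thesis using lip by (intro that linear_growth_field.intro)
qed

theorem theorem6:
  fixes E :: "('n::finite) set set"
    and \<omega> :: "'n set \<Rightarrow> real"
    and \<epsilon> \<alpha> \<eta> :: real
    and \<rho> :: "real \<Rightarrow> real"
    and \<theta> :: "('d::finite + 'd) mlp_params"
    and Agg :: "(real^'d) multiset \<Rightarrow> real^'d"
  defines "F \<equiv> (hnrd_field E \<omega> \<epsilon> \<alpha> \<rho> \<theta> Agg \<eta> :: real^'d^'n \<Rightarrow> real^'d^'n)"
  assumes "weighted_hypergraph E \<omega>"
    and "hg_connected E"
    and "0 < \<epsilon>" and "\<epsilon> < 1"
    and "0 < \<alpha>" and "\<alpha> < 1"
    and "locally_lipschitz (mlp \<rho> \<theta>)"
    and "locally_lipschitz_aggregator TYPE('n) Agg"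
  shows "(\<forall>X0. \<exists>X. global_classical_solution F X0 X \<and>
              (\<forall>Y. global_classical_solution F X0 Y \<longrightarrow> (\<forall>t\<ge>0. Y t = X t)))
         \<and> continuous_semiflow (solution_operator F)"
proof -
  \<comment> \<open>Regularity of the aggregator is available for nonempty node sets; edges have at
    least two nodes.\<close>
  have "e \<noteq> {}" if "e \<in> E" for e
    using assms(2) that unfolding weighted_hypergraph_def by fastforce
  then obtain C where "linear_growth_field F C"
    using linear_growth_field_hnrd[OF assms(4-9)] unfolding F_def by metis
  then interpret linear_growth_field F C .
  show ?thesis using unique_solution solution_operator_semiflow by blast
qed

end
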